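(* Let $n\geqslant 2$. The dimensions of the maximal Lie invariance algebras of the systems of the form $\ddot{\boldsymbol{x}}=D\boldsymbol{x}$, $\boldsymbol{x}(t)=(x^1(t),\dots,x^n(t))^{\rm T}$, where $D$ is a constant complex $n\times n$ matrix with $D\notin\langle E^n\rangle$, are not greater than $n^2+4$, and this upper bound is reached if and only if the matrix $D$ is similar to the nilpotent Jordan matrix $$J_0^2\oplus\Big(\bigoplus_{i=1}^{n-2}J_0^1\Big).$$
   Context: The underlying field is $\mathbb C$ and dimensions are over $\mathbb C$. $E^n$ is the $n\times n$ unit matrix and $\langle E^n\rangle$ is its linear span (so it contains the zero matrix). $J_{\lambda}^{k}$ denotes the $k\times k$ Jordan block with eigenvalue $\lambda$ (entries $\lambda$ on the main diagonal, $1$ on the superdiagonal, $0$ elsewhere). Maximal Lie invariance algebra. For a system $\ddot{\boldsymbol{x}}=\boldsymbol{F}(t,\boldsymbol{x},\dot{\boldsymbol{x}})$ of $n$ second-order ordinary differential equations, consider vector fields $Q=\xi(t,\boldsymbol{x})\partial_t+\eta^a(t,\boldsymbol{x})\partial_{x^a}$ (summation over $a=1,\dots,n$) with smooth coefficients (holomorphic in the complex setting). Write $v^a=\dot x^a$, $D_t=\partial_t+v^a\partial_{x^a}+\ddot x^a\partial_{v^a}$, $\eta^b_{(1)}=D_t\eta^b-v^bD_t\xi$, $\eta^b_{(2)}=D_t\eta^b_{(1)}-\ddot x^bD_t\xi$. The field $Q$ is a Lie symmetry vector field of the system if, for $b=1,\dots,n$, after the substitution $\ddot{\boldsymbol{x}}=\boldsymbol{F}$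 one has $$\eta^b_{(2)}=\xi F^b_t+\eta^aF^b_{x^a}+\eta^a_{(1)}F^b_{v^a}$$ identically in $(t,\boldsymbol{x},\boldsymbol{v})$. The maximal Lie invariance algebra of the system is the Lie algebra of all its Lie symmetry vector fields. For the system $\ddot{\boldsymbol{x}}=D\boldsymbol{x}$ one takes $\boldsymbol{F}=D\boldsymbol{x}$. *)

theory Defs
  imports
    "HOL-Analysis.Analysis"
    "HOL-Library.Function_Algebras"
    "Jordan_Normal_Form.Jordan_Normal_Form"
begin

(* Both HOL-Analysis and Jordan_Normal_Form use infix $; here it always means vec_nth. *)
no_notation Matrix.vec_index (infixl \<open>$\<close> 100)

section \<open>Holomorphic vector fields\<close>

text \<open>A vector field \<open>\<xi> \<partial>\<^sub>t + \<eta>\<^sup>a \<partial>\<^sub>x\<^sub>a\<close> is represented by its coefficient map \<open>(t, x) \<mapsto> (\<xi>, \<eta>)\<close>.\<close>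

type_synonym 'n vfield = "complex \<times> (complex^'n) \<Rightarrow> complex \<times> (complex^'n)"

definition cscale :: "complex \<Rightarrow> complex \<times> (complex^'n) \<Rightarrow> complex \<times> (complex^'n)" where
  "cscale c z = (c * fst z, c *s snd z)"

text \<open>Holomorphy on the whole of \<open>\<complex>\<^sup>1\<^sup>+\<^sup>n\<close>: the (a priori only real-linear) Frechet derivative
  exists everywhere and is complex-linear.\<close>

definition holomorphic_vfield :: "('n::finite) vfield \<Rightarrow> bool" where
  "holomorphic_vfield Q \<longleftrightarrow>
     (\<forall>z. \<exists>L. (Q has_derivative L) (at z) \<and> (\<forall>c h. L (cscale c h) = cscale c (L h)))"

definition vf_scale :: "complex \<Rightarrow> ('n::finite) vfield \<Rightarrow> 'n vfield" where
  "vf_scale c Q = (\<lambda>z. cscale c (Q z))"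

text \<open>\<open>vf.span\<close> and \<open>vf.dim\<close> are span and dimension over \<open>\<complex>\<close>. Note that \<open>vf.dim\<close> takes the
  value 0 on infinite-dimensional spaces.\<close>

global_interpretation vf: vector_space "vf_scale :: complex \<Rightarrow> ('n::finite) vfield \<Rightarrow> 'n vfield"
  by unfold_locales
    (simp_all add: vf_scale_def cscale_def fun_eq_iff prod_eq_iff vec_eq_iff plus_fun_def distrib_left distrib_right)

definition vf_finite_dimensional :: "('n::finite) vfield set \<Rightarrow> bool" where
  "vf_finite_dimensional V \<longleftrightarrow> (\<exists>B. finite B \<and> V \<subseteq> vf.span B)"


section \<open>Prolongation and Lie symmetries\<close>

text \<open>Complex partial derivatives of functions of \<open>(t, x, v)\<close>, where \<open>v = dx/dt\<close>.\<close>

definition pd_t ::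
  "(complex \<Rightarrow> complex^'n \<Rightarrow> complex^'n \<Rightarrow> complex) \<Rightarrow> complex \<Rightarrow> complex^'n \<Rightarrow> complex^'n \<Rightarrow> complex" where
  "pd_t f t x v = deriv (\<lambda>s. f s x v) t"

definition pd_x ::
  "'n \<Rightarrow> (complex \<Rightarrow> complex^'n \<Rightarrow> complex^'n \<Rightarrow> complex) \<Rightarrow> complex \<Rightarrow> complex^'n \<Rightarrow> complex^'n \<Rightarrow> complex" where
  "pd_x a f t x v = deriv (\<lambda>s. f t (x + axis a s) v) 0"

definition pd_v ::
  "'n \<Rightarrow> (complex \<Rightarrow> complex^'n \<Rightarrow> complex^'n \<Rightarrow> complex) \<Rightarrow> complex \<Rightarrow> complex^'n \<Rightarrow> complex^'n \<Rightarrow> complex" where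
  "pd_v a f t x v = deriv (\<lambda>s. f t x (v + axis a s)) 0"

text \<open>\<open>D_t = \<partial>\<^sub>t + v\<^sup>a \<partial>\<^sub>x\<^sub>a + w\<^sup>a \<partial>\<^sub>v\<^sub>a\<close>, where the parameter \<open>w\<close> stands for the second derivative
  of \<open>x\<close>.\<close>

definition total_deriv ::
  "complex^'n \<Rightarrow> (complex \<Rightarrow> complex^'n \<Rightarrow> complex^'n \<Rightarrow> complex) \<Rightarrow>
     complex \<Rightarrow> complex^'n \<Rightarrow> complex^'n \<Rightarrow> complex" where
  "total_deriv w f t x v =
     pd_t f t x v + (\<Sum>a\<in>UNIV. v $ a * pd_x a f t x v) + (\<Sum>a\<in>UNIV. w $ a * pd_v a f t x v)"

definition xi :: "('n::finite) vfield \<Rightarrow> complex \<Rightarrow> complex^'n \<Rightarrow> complex^'n \<Rightarrow> complex" where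
  "xi Q t x v = fst (Q (t, x))"

definition eta :: "('n::finite) vfield \<Rightarrow> 'n \<Rightarrow> complex \<Rightarrow> complex^'n \<Rightarrow> complex^'n \<Rightarrow> complex" where
  "eta Q b t x v = snd (Q (t, x)) $ b"

text \<open>The coefficients \<open>\<eta>\<^sup>b\<^sub>(\<^sub>1\<^sub>)\<close> and \<open>\<eta>\<^sup>b\<^sub>(\<^sub>2\<^sub>)\<close> of the second prolongation. As \<open>\<xi>\<close> and \<open>\<eta>\<close> do not depend
  on \<open>v\<close>, the value of \<open>eta1 w\<close> does not depend on \<open>w\<close>; so keeping \<open>w\<close> fixed in \<open>eta2\<close> while
  differentiating \<open>eta1 w\<close> loses no term.\<close>

definition eta1 ::
  "complex^'n \<Rightarrow> ('n::finite) vfield \<Rightarrow> 'n \<Rightarrow> complex \<Rightarrow> complex^'n \<Rightarrow> complex^'n \<Rightarrow> complex" where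
  "eta1 w Q b t x v = total_deriv w (eta Q b) t x v - v $ b * total_deriv w (xi Q) t x v"

definition eta2 ::
  "complex^'n \<Rightarrow> ('n::finite) vfield \<Rightarrow> 'n \<Rightarrow> complex \<Rightarrow> complex^'n \<Rightarrow> complex^'n \<Rightarrow> complex" where
  "eta2 w Q b t x v = total_deriv w (eta1 w Q b) t x v - w $ b * total_deriv w (xi Q) t x v"

definition lie_symmetry ::
  "(complex \<Rightarrow> complex^'n \<Rightarrow> complex^'n \<Rightarrow> complex^'n) \<Rightarrow> ('n::finite) vfield \<Rightarrow> bool" where
  "lie_symmetry F Q \<longleftrightarrow> holomorphic_vfield Q \<and>
     (\<forall>b t x v. eta2 (F t x v) Q b t x v =
        xi Q t x v * pd_t (\<lambda>t x v. F t x v $ b) t x v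
        + (\<Sum>a\<in>UNIV. eta Q a t x v * pd_x a (\<lambda>t x v. F t x v $ b) t x v)
        + (\<Sum>a\<in>UNIV. eta1 (F t x v) Q a t x v * pd_v a (\<lambda>t x v. F t x v $ b) t x v))"

definition max_lie_algebra ::
  "(complex \<Rightarrow> complex^'n \<Rightarrow> complex^'n \<Rightarrow> complex^'n) \<Rightarrow> ('n::finite) vfield set" where
  "max_lie_algebra F = {Q. lie_symmetry F Q}"

definition linear_system ::
  "complex^'n^'n \<Rightarrow> complex \<Rightarrow> complex^'n \<Rightarrow> complex^'n \<Rightarrow> complex^('n::finite)" where
  "linear_system D t x v = D *v x"


section \<open>Similarity to Jordan matrices\<close>

text \<open>An arbitrary enumeration of the index type turns \<open>D\<close> into a matrix with rows and columns
  numbered from 0 to \<open>n - 1\<close>. Another enumeration gives a similar matrix (conjugation by a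
  permutation matrix), so the choice is immaterial for similarity statements.\<close>

definition index_enum :: "nat \<Rightarrow> 'n::finite" where
  "index_enum = (SOME e. bij_betw e {..<CARD('n)} UNIV)"

lemma bij_betw_index_enum: "bij_betw (index_enum :: nat \<Rightarrow> 'n::finite) {..<CARD('n)} UNIV"
proof -
  have "\<exists>e. bij_betw e {..<CARD('n)} (UNIV :: 'n set)"
    using ex_bij_betw_nat_finite[of "UNIV :: 'n set"] finite_class.finite_UNIV
    by (simp add: atLeast0LessThan)
  then show ?thesis
    unfolding index_enum_def by (rule someI_ex)
qed

definition to_mat :: "'a^'n^'n \<Rightarrow> 'a Matrix.mat" where
  "to_mat A = Matrix.mat CARD('n) CARD('n) (\<lambda>(i, j). A $ index_enum i $ index_enum j)"

text \<open>The direct sum of one block \<open>J\<^sub>0\<^sup>2\<close> and \<open>n - 2\<close> blocks \<open>J\<^sub>0\<^sup>1\<close>.\<close>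

definition extremal_jordan_matrix :: "nat \<Rightarrow> complex Matrix.mat" where
  "extremal_jordan_matrix n = jordan_matrix ((2, 0) # replicate (n - 2) (1, 0))"

text \<open>The span of the unit matrix; \<open>Finite_Cartesian_Product.mat c\<close> is \<open>c\<close> times the unit matrix.\<close>

definition scalar_matrices :: "(complex^'n^'n) set" where
  "scalar_matrices = range Finite_Cartesian_Product.mat"

end

theory Submission
  imports Defs "HOL-Complex_Analysis.Cauchy_Integral_Formula"
begin

text \<open>Write the symmetry condition for \<open>x'' = D x\<close> as a polynomial of degree 3 in the velocity \<open>v\<close>.
Its coefficients are the determining equations (\<open>determining_equations\<close>). They relate
the derivatives of \<open>\<xi>\<close> and \<open>\<eta>\<close> up to the second order, and further differentiation makes them collapse.
Differentiating the linear coefficient along \<open>v\<close> shows that \<open>\<xi>\<^sub>x(v) D v\<close> is parallel to \<open>v\<close>; so if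
\<open>\<xi>\<^sub>x\<close> did not vanish, every vector off a hyperplane would be an eigenvector of \<open>D\<close> and \<open>D\<close> would be
scalar (\<open>xi_independent_of_x\<close>). Differentiating the constant coefficient along \<open>x\<close> and then along
\<open>t\<close> shows in the same way that \<open>\<xi>\<^sub>t\<^sub>t = 0\<close>. Hence the symmetries of a nonscalar system
are exactly the fields
\<open>(\<alpha> + c t) \<partial>\<^sub>t + (\<chi>(t) + \<Gamma> x) \<partial>\<^sub>x\<close> with \<open>\<chi>'' = D \<chi>\<close> and \<open>\<Gamma> D - D \<Gamma> = 2 c D\<close>
(\<open>linear_system_symmetry_form\<close>, \<open>linear_system_symmetryI\<close>).

As \<open>D \<noteq> 0\<close>, the scalar \<open>c\<close> is a function of \<open>\<Gamma>\<close>, and such a field is determined by the vector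
\<open>(\<Gamma>, \<chi>(0), \<chi>'(0), \<alpha>)\<close>, which ranges over a subspace of \<open>S \<times> \<complex>\<^sup>2\<^sup>n\<^sup>+\<^sup>1\<close>, where \<open>S\<close> is the space of all
matrices \<open>\<Gamma>\<close> for which \<open>\<Gamma> D - D \<Gamma>\<close> is a multiple of \<open>D\<close>. So everything depends on the dimension
of \<open>S\<close>. A nonscalar \<open>D\<close> has a vector \<open>u\<close> and a row vector \<open>\<phi>\<close> with \<open>\<phi> u = 0\<close> and \<open>\<phi> D u = 1\<close>.
The space \<open>W\<close> of the matrices \<open>p \<phi> + u \<psi>\<close> has dimension \<open>2 n - 1\<close>, and a matrix in \<open>S \<inter> W\<close> is
determined by two of its coordinates, so the modular law
\<open>dim S + dim W = dim (S + W) + dim (S \<inter> W)\<close> gives \<open>dim S \<le> n\<^sup>2 - 2 n + 3\<close>. In the case of equality all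
values of the two coordinates occur; the two matrices that realise the basic values yield equations
which force \<open>D = (D u) (\<phi> D)\<close> and \<open>D\<^sup>2 = 0\<close> (\<open>dim_sym_params_le\<close>). Conversely, for \<open>D = p q\<close> with
\<open>q p = 0\<close> one has \<open>S + W = \<complex>\<^sup>n\<^sup>\<times>\<^sup>n\<close> and \<open>dim (S \<inter> W) = 2\<close> (\<open>dim_sym_params_rank_one_nilpotent\<close>), and every
initial value of \<open>\<chi>\<close> is taken by a cubic polynomial solution, so the bound \<open>n\<^sup>2 + 4\<close> is attained.
Finally, the nonzero matrices \<open>p q\<close> with \<open>q p = 0\<close> form the similarity class of
\<open>J\<^sub>0\<^sup>2 \<oplus> J\<^sub>0\<^sup>1 \<oplus> \<dots> \<oplus> J\<^sub>0\<^sup>1\<close>.\<close>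

section \<open>Entire functions of several variables\<close>

text \<open>The scalar counterpart of \<open>holomorphic_vfield\<close>: the complex structure of \<open>\<complex> \<times> \<complex>\<^sup>n\<close> is carried by
\<open>cscale\<close>.\<close>
definition holo :: "(complex \<times> (complex^'n::finite) \<Rightarrow> complex) \<Rightarrow> bool" where
  "holo f \<longleftrightarrow> (\<forall>z. \<exists>L. (f has_derivative L) (at z) \<and> (\<forall>c h. L (cscale c h) = c * L h))"

text \<open>The derivative in the direction \<open>h\<close>. All derivatives in \<open>t\<close> and \<open>x\<close> below are of this form, which
reduces the calculus to the linearity of \<open>dd f h z\<close> in \<open>h\<close>.\<close>
definition dd :: "(complex \<times> (complex^'n::finite) \<Rightarrow> complex) \<Rightarrow> complex \<times> (complex^'n) \<Rightarrow>
    complex \<times> (complex^'n) \<Rightarrow> complex" where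
  "dd f h z = deriv (\<lambda>s. f (z + cscale s h)) 0"

lemma cscale_simps [simp]:
  "cscale 0 h = 0" "cscale 1 h = h" "cscale c 0 = 0"
  by (simp_all add: cscale_def prod_eq_iff zero_prod_def)

lemma cscale_add: "cscale (a + b) h = cscale a h + cscale b h"
  and cscale_scaleR: "cscale (r *\<^sub>R a) h = r *\<^sub>R cscale a h"
  by (simp_all add: cscale_def prod_eq_iff Finite_Cartesian_Product.vec_eq_iff algebra_simps
      scaleR_conv_of_real[where ?'a=complex])

lemma bounded_linear_cscale_left: "bounded_linear (\<lambda>c. cscale c (h :: complex \<times> (complex^'n::finite)))"
  by (intro linear_conv_bounded_linear[THEN iffD1] linearI) (simp_all add: cscale_add cscale_scaleR)

lemma holo_line_aux:
  assumes "(f has_derivative L) (at (z + cscale s h))" "\<And>c h. L (cscale c h) = c * L h"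
  shows "((\<lambda>s. f (z + cscale s h)) has_field_derivative L h) (at s)"
proof -
  have "((\<lambda>s. z + cscale s h) has_derivative (\<lambda>s. cscale s h)) (at s)"
    by (auto intro!: derivative_eq_intros bounded_linear.has_derivative[OF bounded_linear_cscale_left])
  from has_derivative_compose[OF this assms(1)]
  have "((\<lambda>s. f (z + cscale s h)) has_derivative (\<lambda>s. L (cscale s h))) (at s)" .
  then show ?thesis
    by (simp add: has_field_derivative_def assms(2) mult.commute[of _ "L h"] fun_eq_iff)
qed

lemma holo_imp:
  assumes "holo f"
  shows holo_has_derivative: "(f has_derivative (\<lambda>h. dd f h z)) (at z)"
    and dd_cscale: "dd f (cscale c h) z = c * dd f h z"
proof -
  obtain L where L: "(f has_derivative L) (at z)" "\<And>c h. L (cscale c h) = c * L h"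
    using assms unfolding holo_def by blast
  have "dd f h z = L h" for h
    unfolding dd_def using holo_line_aux[of f L z 0 h] L by (auto intro!: DERIV_imp_deriv)
  then show "(f has_derivative (\<lambda>h. dd f h z)) (at z)" "dd f (cscale c h) z = c * dd f h z"
    using L by (simp_all add: L(2)) 
qed

lemma holoI: "(\<And>z. (f has_derivative L z) (at z)) \<Longrightarrow> (\<And>z c h. L z (cscale c h) = c * L z h) \<Longrightarrow> holo f"
  unfolding holo_def by blast

lemma dd_unique: "(f has_derivative L) (at z) \<Longrightarrow> (\<And>c h. L (cscale c h) = c * L h) \<Longrightarrow> dd f h z = L h"
  unfolding dd_def using holo_line_aux[of f L z 0 h] by (auto intro!: DERIV_imp_deriv)

lemma dd_add_dir: "holo f \<Longrightarrow> dd f (h + k) z = dd f h z + dd f k z"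
  using holo_has_derivative[of f z] has_derivative_bounded_linear bounded_linear.linear linear_add by blast

lemma holo_line:
  assumes "holo f"
  shows "((\<lambda>s. f (z + cscale s h)) has_field_derivative dd f h (z + cscale s h)) (at s)"
  by (rule holo_line_aux[OF holo_has_derivative[OF assms]]) (rule dd_cscale[OF assms])

lemma holo_continuous: "holo f \<Longrightarrow> continuous_on S f"
  by (meson continuous_at_imp_continuous_on has_derivative_continuous holo_has_derivative)

text \<open>The unit circle as a function on \<open>[0, 1]\<close>, so that contour integrals become integrals over a box.\<close>
abbreviation circ :: "real \<Rightarrow> complex" where "circ \<theta> \<equiv> exp (2 * of_real pi * \<i> * of_real \<theta>)"

text \<open>Cauchy's formula for the derivative at 0 of \<open>s \<mapsto> f (z + s h)\<close> over the unit circle. It expresses a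
derivative of \<open>f\<close> by values of \<open>f\<close>; this is what makes derivatives as regular as \<open>f\<close> itself.\<close>
lemma dd_Cauchy:
  assumes "holo f"
  shows "((\<lambda>\<theta>. f (z + cscale (circ \<theta>) h) / circ \<theta>) has_integral dd f h z) (cbox 0 1)"
proof -
  let ?g = "\<lambda>s. f (z + cscale s h)"
  have hol: "?g holomorphic_on UNIV"
    using holo_line[OF assms, of z h] by (auto simp only: holomorphic_on_open open_UNIV)
  have "((\<lambda>u. ?g u / (u - 0)\<^sup>2) has_contour_integral (2 * of_real pi * \<i> * deriv ?g 0)) (circlepath 0 1)"
  proof -
    have hc: "((\<lambda>u. ?g u/(u - 0) ^ (Suc 1)) has_contour_integral ((2 * pi * \<i>) / (fact 1) * (deriv ^^ 1)
        ?g 0)) (circlepath 0 1)"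
      by (rule Cauchy_has_contour_integral_higher_derivative_circlepath)
        (use hol in \<open>auto intro: holomorphic_on_subset holomorphic_on_imp_continuous_on\<close>)
    then show ?thesis by (simp add: power2_eq_square)
  qed
  then have "((\<lambda>x. ?g (circ x) / (circ x)\<^sup>2 * (2 * of_real pi * \<i> * circ x)) has_integral (2 * of_real pi
      * \<i> * deriv ?g 0)) {0..1}"
    unfolding has_contour_integral_def
  proof (rule has_integral_eq[rotated])
    fix x :: real
    assume "x \<in> {0..1}"
    then have "vector_derivative (circlepath 0 1) (at x within {0..1}) = 2 * of_real pi * \<i> * circ x"
      using vector_derivative_circlepath01[of x 0 1] by simp
    then show "?g (circlepath 0 1 x) / (circlepath 0 1 x - 0)\<^sup>2 *
        vector_derivative (circlepath 0 1) (at x within {0..1}) =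
        ?g (circ x) / (circ x)\<^sup>2 * (2 * of_real pi * \<i> * circ x)"
      by (simp only: circlepath) simp
  qed
  from has_integral_mult_right[OF this, of "1 / (2 * of_real pi * \<i>)"]
  show ?thesis
    unfolding dd_def by (simp add: power2_eq_square field_simps)
qed

lemma continuous_on_cscale [continuous_intros]:
  "continuous_on S c \<Longrightarrow> continuous_on S (\<lambda>x. cscale (c x) (h :: complex \<times> (complex^'n::finite)))"
  by (rule bounded_linear.continuous_on[OF bounded_linear_cscale_left])

lemma holo_continuous_compose [continuous_intros]:
  "holo f \<Longrightarrow> continuous_on S g \<Longrightarrow> continuous_on S (\<lambda>x. f (g x))"
  using continuous_on_compose2[OF holo_continuous[of f UNIV]] by auto

lemma continuous_on_dd:
  assumes "holo f"
  shows "continuous_on UNIV (dd f h)"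
proof -
  have "continuous_on (UNIV \<times> cbox 0 1) (\<lambda>(z, \<theta>). f (z + cscale (circ \<theta>) h) / circ \<theta>)"
    unfolding split_beta by (intro continuous_intros assms) auto
  from integral_continuous_on_param[OF this]
  show ?thesis
    by (simp only: integral_unique[OF dd_Cauchy[OF assms]])
qed

text \<open>Differentiation of Cauchy's integral under the integral sign, which is legitimate because the Frechet
derivative is continuous, again by Cauchy's formula. The derivative in direction \<open>k\<close> of the integral for
\<open>dd f h\<close> is the integral for \<open>dd (dd f k) h\<close>, which gives the symmetry of second derivatives.\<close>
lemma dd_dd:
  assumes f: "holo f"
  shows holo_dd: "holo (dd f h)" and dd_commute: "dd (dd f h) k z = dd (dd f k) h z"
proof -
  define F where "F z = Blinfun (\<lambda>k. dd f k z)" for z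
  have F: "blinfun_apply (F z) k = dd f k z" for z k
    unfolding F_def using holo_has_derivative[OF f, of z]
    by (subst bounded_linear_Blinfun_apply) (auto dest: has_derivative_bounded_linear)
  have "continuous_on UNIV F"
    by (intro continuous_on_blinfun_componentwise) (simp add: F continuous_on_dd[OF f] )
  note cF = continuous_on_compose2[OF this _ subset_UNIV]
  define fx where "fx h z \<theta> = blinfun_mult_right (inverse (circ \<theta>)) o\<^sub>L F (z + cscale (circ \<theta>) h)" for h z \<theta>
  have fx: "blinfun_apply (fx h z \<theta>) k = dd f k (z + cscale (circ \<theta>) h) / circ \<theta>" for h z \<theta> k
    by (simp add: fx_def F field_simps)
  have cfx: "continuous_on (UNIV \<times> cbox 0 1) (\<lambda>(z, \<theta>). fx h z \<theta>)" for h
    unfolding split_beta fx_def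
    by (intro continuous_intros cF bounded_linear.continuous_on[OF bounded_linear_blinfun_mult_right]) auto
  have ifx: "fx h z integrable_on cbox 0 1" for h z
    unfolding fx_def
    by (intro integrable_continuous continuous_intros cF bounded_linear.continuous_on[OF
        bounded_linear_blinfun_mult_right]) auto
  have D: "(dd f h has_derivative (\<lambda>k. integral (cbox 0 1) (\<lambda>\<theta>. dd f k (z
      + cscale (circ \<theta>) h) / circ \<theta>))) (at z)" for h z
  proof -
    have "((\<lambda>z. integral (cbox 0 1) (\<lambda>\<theta>. f (z + cscale (circ \<theta>) h) / circ \<theta>)) has_derivative
        blinfun_apply (integral (cbox 0 1) (fx h z))) (at z within UNIV)"
    proof (rule leibniz_rule[OF _ _ cfx])
      fix z \<theta>
      have "((\<lambda>z. f (z + cscale (circ \<theta>) h)) has_derivative (\<lambda>k. dd f k (z + cscale (circ \<theta>) h))) (at z)"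
        by (rule has_derivative_compose[OF _ holo_has_derivative[OF f]]) (auto intro!: derivative_eq_intros)
      then show "((\<lambda>z. f (z + cscale (circ \<theta>) h) / circ \<theta>) has_derivative blinfun_apply (fx h z \<theta>)) (at z
          within UNIV)"
        unfolding fx by (rule bounded_linear.has_derivative[OF bounded_linear_divide])
    qed (rule UNIV_I convex_UNIV has_integral_integrable[OF dd_Cauchy[OF f]])+
    moreover have "blinfun_apply (integral (cbox 0 1) (fx h z))
        = (\<lambda>k. integral (cbox 0 1) (\<lambda>\<theta>. dd f k (z + cscale (circ \<theta>) h) / circ \<theta>))"
      by (rule ext) (simp only: blinfun_apply_integral[OF ifx] fx)
    ultimately show ?thesis
      by (simp only: integral_unique[OF dd_Cauchy[OF f]])
  qed
  have lin: "integral (cbox 0 1) (\<lambda>\<theta>. dd f (cscale c k) (z + cscale (circ \<theta>) h) / circ \<theta>) =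
     c * integral (cbox 0 1) (\<lambda>\<theta>. dd f k (z + cscale (circ \<theta>) h) / circ \<theta>)" for c h k z
    by (simp add: dd_cscale[OF f] flip: integral_mult_right)
  show H: "holo (dd f h)" for h
    by (rule holoI[OF D lin])
  show "dd (dd f h) k z = dd (dd f k) h z"
    by (subst dd_unique[OF D lin]) (rule integral_unique[OF dd_Cauchy[OF H]])
qed

lemma
  assumes "holo f" "holo g"
  shows holo_add: "holo (\<lambda>z. f z + g z)" and dd_add: "dd (\<lambda>z. f z + g z) h z = dd f h z + dd g h z"
    and holo_diff: "holo (\<lambda>z. f z - g z)" and dd_diff: "dd (\<lambda>z. f z - g z) h z = dd f h z - dd g h z"
    and holo_mult: "holo (\<lambda>z. f z * g z)" and dd_mult: "dd (\<lambda>z. f z * g z) h z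
        = dd f h z * g z + f z * dd g h z"
proof -
  note D = holo_has_derivative[OF assms(1)] holo_has_derivative[OF assms(2)]
  note L = dd_cscale[OF assms(1)] dd_cscale[OF assms(2)]
  have *: "((\<lambda>z. f z + g z) has_derivative (\<lambda>h. dd f h z + dd g h z)) (at z)"
    "((\<lambda>z. f z - g z) has_derivative (\<lambda>h. dd f h z - dd g h z)) (at z)"
    "((\<lambda>z. f z * g z) has_derivative (\<lambda>h. dd f h z * g z + f z * dd g h z)) (at z)" for z
    using D[of z] by (auto intro!: derivative_eq_intros simp: algebra_simps)
  show "holo (\<lambda>z. f z + g z)" by (rule holoI[OF *(1)]) (simp add: L algebra_simps)
  show "holo (\<lambda>z. f z - g z)" by (rule holoI[OF *(2)]) (simp add: L algebra_simps)
  show "holo (\<lambda>z. f z * g z)" by (rule holoI[OF *(3)]) (simp add: L algebra_simps)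
  show "dd (\<lambda>z. f z + g z) h z = dd f h z + dd g h z"
      by (subst dd_unique[OF *(1)]) (simp_all add: L algebra_simps)
  show "dd (\<lambda>z. f z - g z) h z = dd f h z - dd g h z"
      by (subst dd_unique[OF *(2)]) (simp_all add: L algebra_simps)
  show "dd (\<lambda>z. f z * g z) h z = dd f h z * g z + f z * dd g h z"
      by (subst dd_unique[OF *(3)]) (simp_all add: L algebra_simps)
qed

lemma
  fixes z :: "complex \<times> (complex^'n::finite)"
  shows holo_const: "holo (\<lambda>z :: complex \<times> (complex^'n). c)" and dd_const: "dd (\<lambda>z. c) h z = 0"
proof -
  have *: "((\<lambda>z. c) has_derivative (\<lambda>h. 0)) (at z)"
      for z :: "complex \<times> (complex^'n::finite)" and c :: complex by simp
  show "holo (\<lambda>z :: complex \<times> (complex^'n). c)" by (rule holoI[OF *]) simp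
  show "dd (\<lambda>z. c) h z = 0" by (subst dd_unique[OF *]) simp_all
qed

lemma dd_cmult: "holo f \<Longrightarrow> dd (\<lambda>z. c * f z) h z = c * dd f h z"
  and holo_cmult: "holo f \<Longrightarrow> holo (\<lambda>z. c * f z)"
  using dd_mult[OF holo_const[of c]] by (simp_all add: dd_const holo_mult holo_const)

lemma holo_sum: "(\<And>i. i \<in> I \<Longrightarrow> holo (f i)) \<Longrightarrow> holo (\<lambda>z. \<Sum>i\<in>I. f i z)"
  and dd_sum: "(\<And>i. i \<in> I \<Longrightarrow> holo (f i)) \<Longrightarrow> dd (\<lambda>z. \<Sum>i\<in>I. f i z) h z = (\<Sum>i\<in>I. dd (f i) h z)"
proof -
  have "(\<And>i. i \<in> I \<Longrightarrow> holo (f i)) \<Longrightarrow> holo (\<lambda>z. \<Sum>i\<in>I. f i z) \<and> dd (\<lambda>z. \<Sum>i\<in>I. f i z) h z = (\<Sum>i\<in>I. dd (f i) h z)"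
    by (induction I rule: infinite_finite_induct) (auto simp: holo_const dd_const holo_add dd_add)
  then show "(\<And>i. i \<in> I \<Longrightarrow> holo (f i)) \<Longrightarrow> holo (\<lambda>z. \<Sum>i\<in>I. f i z)"
    "(\<And>i. i \<in> I \<Longrightarrow> holo (f i)) \<Longrightarrow> dd (\<lambda>z. \<Sum>i\<in>I. f i z) h z = (\<Sum>i\<in>I. dd (f i) h z)"
    by blast+
qed

lemma
  fixes z :: "complex \<times> (complex^'n::finite)"
  shows holo_coord: "holo (\<lambda>z :: complex \<times> (complex^'n). snd z $ a)"
    and dd_coord: "dd (\<lambda>z. snd z $ a) h z = snd h $ a"
    and holo_fst: "holo (fst :: complex \<times> (complex^'n) \<Rightarrow> _)" and dd_fst: "dd fst h z = fst h"
proof -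
  have *: "((\<lambda>z. snd z $ a) has_derivative (\<lambda>h. snd h $ a)) (at z)" "(fst has_derivative fst) (at z)" 
    for z :: "complex \<times> (complex^'n::finite)" and a
    by (auto intro!: bounded_linear_imp_has_derivative bounded_linear_compose[OF bounded_linear_vec_nth]
        bounded_linear_snd bounded_linear_fst)
  show "holo (\<lambda>z. snd z $ a)" by (rule holoI[OF *(1)]) (simp add: cscale_def)
  show "dd (\<lambda>z. snd z $ a) h z = snd h $ a" by (subst dd_unique[OF *(1)]) (simp_all add: cscale_def)
  show "holo (fst :: complex \<times> (complex^'n) \<Rightarrow> _)" by (rule holoI[OF *(2)]) (simp add: cscale_def)
  show "dd fst h z = fst h" by (subst dd_unique[OF *(2)]) (simp_all add: cscale_def)
qed

lemma dd_0_dir: "holo f \<Longrightarrow> dd f 0 z = 0"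
  using dd_cscale[of f 0 0 z] by simp

lemma dd_sum_dir: "holo f \<Longrightarrow> dd f (\<Sum>i\<in>I. h i) z = (\<Sum>i\<in>I. dd f (h i) z)"
  by (induction I rule: infinite_finite_induct) (auto simp: dd_0_dir dd_add_dir)

lemma vec_axis_expansion: "(0, v) = (\<Sum>a\<in>UNIV. cscale (v $ a) (0 :: complex, axis a 1))"
  by (simp add: cscale_def prod_eq_iff Finite_Cartesian_Product.vec_eq_iff fst_sum snd_sum axis_def
      if_distrib cong: if_cong)

lemma dd_vec_dir:
  assumes "holo f"
  shows "dd f (0, v) z = (\<Sum>a\<in>UNIV. v $ a * dd f (0, axis a 1) z)"
  by (subst vec_axis_expansion) (simp add: dd_sum_dir assms dd_cscale)

lemma dd_pair_dir: "holo f \<Longrightarrow> dd f (c, v) z = c * dd f (1, 0) z + dd f (0, v) z"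
  using dd_add_dir[of f "cscale c (1, 0)" "(0, v)" z] by (simp add: dd_cscale) (simp add: cscale_def)

lemma dd_vec_cscale: "holo f \<Longrightarrow> dd f (0, c *s v) z = c * dd f (0, v) z"
  using dd_cscale[of f c "(0, v)" z] by (simp add: cscale_def)

lemma dd_t_dir:
  assumes "holo f"
  shows "((\<lambda>s. f (s, x)) has_field_derivative dd f (1, 0) (t, x)) (at t)"
  using holo_line[OF assms, of "(0, x)" "(1, 0)" t] by (simp add: cscale_def)

lemma dd_x_dir:
  assumes "holo f"
  shows "((\<lambda>s. f (t, x + axis a s)) has_field_derivative dd f (0, axis a 1) (t, x + axis a s)) (at s)"
proof -
  have "s *s axis a 1 = axis a s" for s :: complex
    by (simp add: Finite_Cartesian_Product.vec_eq_iff axis_def)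
  then show ?thesis
    using holo_line[OF assms, of "(t, x)" "(0, axis a 1)" s] by (simp add: cscale_def)
qed

section \<open>The symmetry condition for a linear system\<close>

lemma holomorphic_vfield_iff:
  "holomorphic_vfield Q \<longleftrightarrow> holo (\<lambda>z. fst (Q z)) \<and> (\<forall>b. holo (\<lambda>z. snd (Q z) $ b))"
proof safe
  assume Q: "holomorphic_vfield Q"
  then obtain L where L: "\<And>z. (Q has_derivative L z) (at z)" "\<And>z c h. L z (cscale c h) = cscale c (L z h)"
    unfolding holomorphic_vfield_def by metis
  show "holo (\<lambda>z. fst (Q z))"
    by (rule holoI[OF has_derivative_fst[OF L(1)]]) (simp add: L(2), simp add: cscale_def)
  show "holo (\<lambda>z. snd (Q z) $ b)" for b
    by (rule holoI[OF bounded_linear.has_derivative[OF bounded_linear_vec_nth has_derivative_snd[OF L(1)]]])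
      (simp add: L(2), simp add: cscale_def)
next
  assume X: "holo (\<lambda>z. fst (Q z))" and Y: "\<forall>b. holo (\<lambda>z. snd (Q z) $ b)"
  show "holomorphic_vfield Q"
    unfolding holomorphic_vfield_def
  proof (intro allI exI conjI)
    fix z
    have "((\<lambda>z. snd (Q z)) has_derivative (\<lambda>h. \<chi> b. dd (\<lambda>z. snd (Q z) $ b) h z)) (at z)"
      using Y by (subst has_derivative_componentwise_within)
        (auto simp: Basis_vec_def inner_axis intro!: derivative_intros holo_has_derivative)
    from has_derivative_Pair[OF holo_has_derivative[OF X] this]
    show "(Q has_derivative (\<lambda>h. (dd (\<lambda>z. fst (Q z)) h z, \<chi> b. dd (\<lambda>z. snd (Q z) $ b) h z))) (at z)"
      by simp
    show "(dd (\<lambda>z. fst (Q z)) (cscale c h) z, \<chi> b. dd (\<lambda>z. snd (Q z) $ b) (cscale c h) z) =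
      cscale c (dd (\<lambda>z. fst (Q z)) h z, \<chi> b. dd (\<lambda>z. snd (Q z) $ b) h z)" for c h
      using Y by (simp add: dd_cscale X, simp add: cscale_def Finite_Cartesian_Product.vec_eq_iff)
  qed
qed

text \<open>On functions that are holomorphic in \<open>(t, x)\<close>, the part \<open>\<partial>\<^sub>t + v\<^sup>a \<partial>\<^sub>x\<^sub>a\<close> of the total derivative is the
derivative in the direction \<open>(1, v)\<close> with \<open>v\<close> held fixed.\<close>
lemma total_deriv_holo:
  assumes "\<And>v. holo (g v)"
  shows "total_deriv w (\<lambda>t x v. g v (t, x)) t x v =
    dd (g v) (1, v) (t, x) + (\<Sum>a\<in>UNIV. w $ a * deriv (\<lambda>s. g (v + axis a s) (t, x)) 0)"
proof -
  have "pd_t (\<lambda>t x v. g v (t, x)) t x v = dd (g v) (1, 0) (t, x)"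
    unfolding pd_t_def by (rule DERIV_imp_deriv[OF dd_t_dir[OF assms]])
  moreover have "axis a (0::complex) = 0" for a :: 'a
    by (simp add: axis_def Finite_Cartesian_Product.vec_eq_iff)
  note this[simp]
  have "pd_x a (\<lambda>t x v. g v (t, x)) t x v = dd (g v) (0, axis a 1) (t, x)" for a
    unfolding pd_x_def using dd_x_dir[OF assms, of v t x a 0] by (intro DERIV_imp_deriv) simp
  ultimately show ?thesis
    using assms by (simp add: total_deriv_def pd_v_def dd_pair_dir[of _ 1 v] dd_vec_dir[of _ v])
qed

text \<open>In \<open>\<eta>\<^sub>(\<^sub>1\<^sub>)\<close> the velocity occurs in the direction \<open>(1, v)\<close>, which is affine in \<open>v\<close>, and in the factor
\<open>v\<^sup>b\<close>. Hence its \<open>v\<close>-derivatives give the terms along \<open>(0, w)\<close> and one of the two terms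
\<open>w\<^sup>b D\<^sub>t \<xi>\<close>.\<close>
lemma prolongation_eq:
  fixes Q :: "('n::finite) vfield"
  defines "X \<equiv> \<lambda>z. fst (Q z)" and "Y \<equiv> \<lambda>b z. snd (Q z) $ b"
  assumes X: "holo X" and Y: "\<And>b. holo (Y b)"
  shows "eta2 w Q b t x v = dd (dd (Y b) (1, v)) (1, v) (t, x) + dd (Y b) (0, w) (t, x)
     - v $ b * (dd (dd X (1, v)) (1, v) (t, x) + dd X (0, w) (t, x)) - 2 * w $ b * dd X (1, v) (t, x)"
    (is "_ = ?rhs")
proof -
  have xi: "xi Q = (\<lambda>t x v. X (t, x))" and eta: "eta Q b = (\<lambda>t x v. Y b (t, x))"
    by (simp_all add: fun_eq_iff xi_def eta_def X_def Y_def)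
  have tX: "total_deriv w (xi Q) t x v = dd X (1, v) (t, x)" 
    and tY: "total_deriv w (eta Q b) t x v = dd (Y b) (1, v) (t, x)" for t x v
    unfolding xi eta using total_deriv_holo[of "\<lambda>_. X"] total_deriv_holo[of "\<lambda>_. Y b"] by (simp_all add: X Y)
  define g where "g v z = dd (Y b) (1, v) z - v $ b * dd X (1, v) z" for v z
  have g: "holo (g v)" for v
    unfolding g_def by (intro holo_diff holo_cmult holo_dd X Y)
  have eta1: "eta1 w Q b = (\<lambda>t x v. g v (t, x))"
    by (simp add: fun_eq_iff eta1_def tX tY g_def)
  have dg: "deriv (\<lambda>s. g (v + axis a s) (t, x)) 0 =
      dd (Y b) (0, axis a 1) (t, x) - (if a = b then dd X (1, v) (t, x) else 0)
          - v $ b * dd X (0, axis a 1) (t, x)" for a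
  proof (rule DERIV_imp_deriv)
    have ax: "(1 :: complex, v + axis a s) = (1, v) + cscale s (0, axis a 1)" for s
      by (simp add: cscale_def Finite_Cartesian_Product.vec_eq_iff axis_def)
    have "g (v + axis a s) (t, x) = dd (Y b) (1, v) (t, x) + s * dd (Y b) (0, axis a 1) (t, x)
      - (v $ b + (if a = b then s else 0)) * (dd X (1, v) (t, x) + s * dd X (0, axis a 1) (t, x))" for s
      unfolding g_def ax by (simp add: dd_add_dir dd_cscale X Y) (simp add: axis_def)
    then show "((\<lambda>s. g (v + axis a s) (t, x)) has_field_derivative
       dd (Y b) (0, axis a 1) (t, x) - (if a = b then dd X (1, v) (t, x) else 0)
           - v $ b * dd X (0, axis a 1) (t, x)) (at 0)"
      by (auto intro!: derivative_eq_intros)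
  qed
  have "eta2 w Q b t x v = dd (g v) (1, v) (t, x) + (\<Sum>a\<in>UNIV. w $ a * deriv (\<lambda>s. g (v + axis a s) (t, x)) 0)
     - w $ b * dd X (1, v) (t, x)"
    by (simp add: eta2_def eta1 total_deriv_holo[OF g] tX)
  also have "dd (g v) (1, v) (t, x) = dd (dd (Y b) (1, v)) (1, v) (t, x)
      - v $ b * dd (dd X (1, v)) (1, v) (t, x)"
    unfolding g_def by (simp add: dd_diff dd_cmult holo_cmult holo_dd X Y)
  also have "(\<Sum>a\<in>UNIV. w $ a * deriv (\<lambda>s. g (v + axis a s) (t, x)) 0) =
     dd (Y b) (0, w) (t, x) - w $ b * dd X (1, v) (t, x) - v $ b * dd X (0, w) (t, x)"
  proof -
    have "(\<Sum>a\<in>UNIV. w $ a * (if a = b then dd X (1, v) (t, x) else 0)) = w $ b * dd X (1, v) (t, x)"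
      by (simp add: if_distrib cong: if_cong)
    then show ?thesis
      unfolding dg dd_vec_dir[OF X, of w] dd_vec_dir[OF Y, of _ w]
      by (simp add: right_diff_distrib sum_subtractf sum_distrib_left mult.left_commute)
  qed
  finally show ?thesis
    by (simp add: algebra_simps)
qed

lemma lie_symmetry_linear_iff:
  fixes Q :: "('n::finite) vfield" and D :: "complex^'n^'n"
  defines "X \<equiv> \<lambda>z. fst (Q z)" and "Y \<equiv> \<lambda>b z. snd (Q z) $ b"
  shows "lie_symmetry (linear_system D) Q \<longleftrightarrow> holo X \<and> (\<forall>b. holo (Y b)) \<and>
    (\<forall>b t x v. dd (dd (Y b) (1, v)) (1, v) (t, x) + dd (Y b) (0, D *v x) (t, x)
     - v $ b * (dd (dd X (1, v)) (1, v) (t, x) + dd X (0, D *v x) (t, x))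
         - 2 * (D *v x) $ b * dd X (1, v) (t, x)
     = (\<Sum>a\<in>UNIV. D $ b $ a * Y a (t, x)))"
proof -
  have "pd_t (\<lambda>t x v. linear_system D t x v $ b) t x v = 0" for b t x v
    by (simp add: pd_t_def linear_system_def)
  moreover have "pd_v a (\<lambda>t x v. linear_system D t x v $ b) t x v = 0" for a b t x v
    by (simp add: pd_v_def linear_system_def)
  moreover have "pd_x a (\<lambda>t x v. linear_system D t x v $ b) t x v = D $ b $ a" for a b t x v
    unfolding pd_x_def
  proof (rule DERIV_imp_deriv)
    have "linear_system D t (x + axis a s) v $ b = (D *v x) $ b + s * D $ b $ a" for s
      by (simp add: linear_system_def matrix_vector_right_distrib)
        (simp add: matrix_vector_mult_def axis_def if_distrib cong: if_cong)
    then show "((\<lambda>s. linear_system D t (x + axis a s) v $ b) has_field_derivative D $ b $ a) (at 0)"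
      by (auto intro!: derivative_eq_intros)
  qed
  moreover have "eta Q a t x v = Y a (t, x)" for a t x v
    by (simp add: eta_def Y_def)
  moreover have "holomorphic_vfield Q \<longleftrightarrow> holo X \<and> (\<forall>b. holo (Y b))"
    by (simp add: holomorphic_vfield_iff X_def Y_def)
  moreover have "eta2 w Q b t x v = dd (dd (Y b) (1, v)) (1, v) (t, x) + dd (Y b) (0, w) (t, x)
     - v $ b * (dd (dd X (1, v)) (1, v) (t, x) + dd X (0, w) (t, x)) - 2 * w $ b * dd X (1, v) (t, x)"
    if "holo X" "\<forall>b. holo (Y b)" for w b t x v
    unfolding X_def Y_def by (rule prolongation_eq) (use that in \<open>simp_all add: X_def Y_def\<close>)
  ultimately show ?thesis
    unfolding lie_symmetry_def by (auto simp: linear_system_def mult.commute)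
qed

section \<open>The determining equations\<close>

abbreviation T :: "complex \<times> (complex^'n::finite)" where "T \<equiv> (1, 0)"

lemma second_dd_expand:
  assumes f: "holo f"
  shows "dd (dd f (1, s *s v)) (1, s *s v) z =
    dd (dd f T) T z + 2 * s * dd (dd f T) (0, v) z + s\<^sup>2 * dd (dd f (0, v)) (0, v) z"
proof -
  have "dd f (1, s *s v) = (\<lambda>z. dd f T z + s * dd f (0, v) z)"
    by (rule ext) (simp add: dd_pair_dir[OF f, of 1 "s *s v"] dd_vec_cscale[OF f])
  then have "dd (dd f (1, s *s v)) h z = dd (dd f T) h z + s * dd (dd f (0, v)) h z" for h
    by (simp add: dd_add dd_cmult holo_dd holo_cmult f)
  then show ?thesis
    using dd_commute[OF f, of "(0, v)" T z]
    by (simp add: dd_pair_dir[of _ 1 "s *s v"] dd_vec_cscale holo_dd f algebra_simps power2_eq_square)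
qed

lemma cubic_eq_0:
  fixes c0 c1 c2 c3 :: complex
  assumes "\<And>s. c0 + c1 * s + c2 * s\<^sup>2 + c3 * s ^ 3 = 0"
  shows "c0 = 0" "c1 = 0" "c2 = 0" "c3 = 0"
proof -
  show c0: "c0 = 0" using assms[of 0] by simp
  have a: "c1 + c2 + c3 = 0" "- c1 + c2 - c3 = 0" "2 * c1 + 4 * c2 + 8 * c3 = 0"
    using assms[of 1] assms[of "-1"] assms[of 2] c0 by (simp_all add: algebra_simps)
  have "c2 = ((c1 + c2 + c3) + (- c1 + c2 - c3)) / 2" by simp
  then show c2: "c2 = 0" unfolding a by simp
  have "c3 = ((2 * c1 + 4 * c2 + 8 * c3) - 2 * (c1 + c2 + c3) - 2 * c2) / 6" by simp
  then show "c3 = 0" unfolding a by (simp add: c2)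
  then show "c1 = 0" using a(1) c2 by simp
qed

text \<open>Replacing \<open>v\<close> by \<open>s v\<close> turns the symmetry condition into a polynomial in \<open>s\<close>, and its four
coefficients vanish separately.\<close>
lemma determining_equations:
  fixes Q :: "('n::finite) vfield" and D :: "complex^'n^'n"
  defines "X \<equiv> \<lambda>z. fst (Q z)" and "Y \<equiv> \<lambda>b z. snd (Q z) $ b"
  assumes "lie_symmetry (linear_system D) Q"
  shows "holo X" "holo (Y b)"
    and "dd (dd (Y b) T) T z + dd (Y b) (0, D *v snd z) z - 2 * (D *v snd z) $ b * dd X T z
        = (\<Sum>a\<in>UNIV. D $ b $ a * Y a z)"
    and "2 * dd (dd (Y b) T) (0, v) z = v $ b * (dd (dd X T) T z + dd X (0, D *v snd z) z)
        + 2 * (D *v snd z) $ b * dd X (0, v) z"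
    and "dd (dd (Y b) (0, v)) (0, v) z = 2 * v $ b * dd (dd X T) (0, v) z"
    and "dd (dd X (0, v)) (0, v) z = 0"
proof -
  show X: "holo X" and Y: "holo (Y b)" for b
    using assms(3) unfolding lie_symmetry_linear_iff X_def Y_def by blast+
  let ?w = "D *v snd z"
  have c: "(dd (dd (Y b) T) T z + dd (Y b) (0, ?w) z - 2 * ?w $ b * dd X T z - (\<Sum>a\<in>UNIV. D $ b $ a * Y a z))
     + (2 * dd (dd (Y b) T) (0, v) z - v $ b * (dd (dd X T) T z + dd X (0, ?w) z)
         - 2 * ?w $ b * dd X (0, v) z) * s
     + (dd (dd (Y b) (0, v)) (0, v) z - 2 * v $ b * dd (dd X T) (0, v) z) * s\<^sup>2
     + (- v $ b * dd (dd X (0, v)) (0, v) z) * s ^ 3 = 0" for s v b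
  proof -
    have "dd (dd (Y b) (1, s *s v)) (1, s *s v) z + dd (Y b) (0, ?w) z
     - (s *s v) $ b * (dd (dd X (1, s *s v)) (1, s *s v) z + dd X (0, ?w) z) - 2 * ?w $ b * dd X (1, s *s v) z
     = (\<Sum>a\<in>UNIV. D $ b $ a * Y a z)"
      using assms(3)[unfolded lie_symmetry_linear_iff, THEN conjunct2, THEN conjunct2,
          THEN spec[of _ b], THEN spec[of _ "fst z"], THEN spec[of _ "snd z"], THEN spec[of _ "s *s v"]]
      unfolding X_def Y_def by simp
    then show ?thesis
      by (simp add: second_dd_expand X Y dd_pair_dir[of X 1 "s *s v"] dd_vec_cscale algebra_simps
          power2_eq_square power3_eq_cube)
  qed
  note c = cubic_eq_0[OF c]
  show "dd (dd (Y b) T) T z + dd (Y b) (0, D *v snd z) z - 2 * (D *v snd z) $ b * dd X T z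
      = (\<Sum>a\<in>UNIV. D $ b $ a * Y a z)"
    using c(1)[of b] by simp
  show "2 * dd (dd (Y b) T) (0, v) z = v $ b * (dd (dd X T) T z + dd X (0, D *v snd z) z)
      + 2 * (D *v snd z) $ b * dd X (0, v) z"
    using c(2)[of b v] by (simp add: algebra_simps)
  show "dd (dd (Y b) (0, v)) (0, v) z = 2 * v $ b * dd (dd X T) (0, v) z"
    using c(3)[of b v] by simp
  show "dd (dd X (0, v)) (0, v) z = 0"
  proof (cases "v = 0")
    case True
    then show ?thesis using dd_0_dir[OF holo_dd[OF X]] by (simp add: zero_prod_def)
  next
    case False
    then obtain b where "v $ b \<noteq> 0" by (auto simp: Finite_Cartesian_Product.vec_eq_iff)
    then show ?thesis using c(4)[of v b] by simp
  qed
qed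

lemma scalar_matrixI:
  fixes D :: "complex^'n^'n::finite"
  assumes "\<And>v. D *v v = \<mu> *s v"
  shows "D \<in> scalar_matrices"
proof -
  have "Finite_Cartesian_Product.mat \<mu> *v v = \<mu> *s v" for v :: "complex^'n"
    by (simp add: matrix_vector_mult_def Finite_Cartesian_Product.mat_def
        Finite_Cartesian_Product.vec_eq_iff if_distrib[where f="\<lambda>x. x * _"] cong: if_cong)
  then have "D = Finite_Cartesian_Product.mat \<mu>"
    using assms by (simp add: matrix_eq)
  then show ?thesis unfolding scalar_matrices_def by blast
qed

text \<open>If \<open>u\<close> is off the hyperplane \<open>l = 0\<close> and \<open>w\<close> is on it, then \<open>u\<close>, \<open>u + w\<close> and \<open>u + 2 w\<close> are all
eigenvectors, and a comparison of their eigenvalues shows that \<open>D\<close> multiplies \<open>w\<close> by the eigenvalue of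
\<open>u\<close>.\<close>
lemma scalar_if_eigenvectors_off_hyperplane:
  fixes D :: "complex^'n^'n::finite" and l :: "complex^'n \<Rightarrow> complex"
  assumes add: "\<And>v w. l (v + w) = l v + l w" and scale: "\<And>c v. l (c *s v) = c * l v"
    and u: "l u \<noteq> 0" and eig: "\<And>v. l v \<noteq> 0 \<Longrightarrow> \<exists>\<mu>. D *v v = \<mu> *s v"
  shows "D \<in> scalar_matrices"
proof -
  obtain \<mu> where \<mu>: "D *v u = \<mu> *s u" using eig[OF u] by blast
  have ker: "D *v w = \<mu> *s w" if w: "l w = 0" for w
  proof -
    have "l (u + w) \<noteq> 0" "l (u + 2 *s w) \<noteq> 0"
      using u w by (simp_all add: add scale)
    then obtain \<mu>1 \<mu>2 where 1: "D *v (u + w) = \<mu>1 *s (u + w)" and 2: "D *v (u + 2 *s w) = \<mu>2 *s (u + 2 *s w)"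
      using eig by metis
    have e1: "D *v w = (\<mu>1 - \<mu>) *s u + \<mu>1 *s w"
      using 1 unfolding matrix_vector_right_distrib \<mu>
      by (simp add: Finite_Cartesian_Product.vec_eq_iff algebra_simps)
    have "\<mu> *s u + 2 *s (D *v w) = \<mu>2 *s (u + 2 *s w)"
      using 2 unfolding matrix_vector_right_distrib \<mu> vector_scalar_commute .
    then have eq: "(2 * \<mu>1 - \<mu> - \<mu>2) *s u + (2 * \<mu>1 - 2 * \<mu>2) *s w = 0"
      unfolding e1 by (simp add: Finite_Cartesian_Product.vec_eq_iff algebra_simps)
    have l0: "l 0 = 0" using scale[of 0 0] by simp
    have "(2 * \<mu>1 - \<mu> - \<mu>2) * l u = 0"
      using arg_cong[OF eq, of l] unfolding add scale w l0 by simp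
    then have *: "2 * \<mu>1 - \<mu> - \<mu>2 = 0" using u by simp
    have "(2 * \<mu>1 - 2 * \<mu>2) *s w = 0"
      using eq unfolding * by simp
    then have "w = 0 \<or> \<mu>1 = \<mu>" using * by auto
    then show ?thesis
      using e1 by auto
  qed
  have "D *v w = \<mu> *s w" for w
  proof -
    define c where "c = l w / l u"
    have "l (w + (- c) *s u) = 0" unfolding add scale c_def using u by simp
    from ker[OF this] have "D *v w + (- c) *s (\<mu> *s u) = \<mu> *s (w + (- c) *s u)"
      unfolding matrix_vector_right_distrib vector_scalar_commute \<mu> .
    then show ?thesis
      by (simp add: Finite_Cartesian_Product.vec_eq_iff algebra_simps)
  qed
  then show ?thesis by (rule scalar_matrixI)
qed

lemma dd_zero_imp_eq:
  assumes f: "holo f" and 0: "\<And>z. dd f h z = 0"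
  shows "f (z + h) = f z"
proof -
  have "((\<lambda>s. f (z + cscale s h)) has_field_derivative 0) (at s within UNIV)" for s
    using holo_line[OF f, of z h s] by (simp add: 0)
  then obtain c where "\<And>s. f (z + cscale s h) = c"
    using has_field_derivative_zero_constant[OF convex_UNIV, of "\<lambda>s. f (z + cscale s h)"] by auto
  from this[of 0] this[of 1] show ?thesis by simp
qed

lemma holo_matrix_coord: "holo (\<lambda>z. (D *v snd z) $ b)" and dd_matrix_coord: "dd (\<lambda>z. (D *v snd z) $ b) h
    z = (D *v snd h) $ b"
  unfolding matrix_vector_mult_def by (simp_all add: holo_sum dd_sum holo_cmult dd_cmult holo_coord dd_coord)

lemma
  fixes D :: "complex^'n^'n::finite"
  assumes f: "holo f"
  shows holo_dd_matrix: "holo (\<lambda>z. dd f (0, D *v snd z) z)"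
    and dd_dd_matrix: "dd (\<lambda>z. dd f (0, D *v snd z) z) h z =
      dd f (0, D *v snd h) z + (\<Sum>a\<in>UNIV. (D *v snd z) $ a * dd (dd f (0, axis a 1)) h z)"
proof -
  have *: "(\<lambda>z. dd f (0, D *v snd z) z) = (\<lambda>z. \<Sum>a\<in>UNIV. (D *v snd z) $ a * dd f (0, axis a 1) z)"
    by (rule ext) (rule dd_vec_dir[OF f])
  note h = holo_mult[OF holo_matrix_coord holo_dd[OF f]]
  show "holo (\<lambda>z. dd f (0, D *v snd z) z)"
    unfolding * by (rule holo_sum[OF h])
  show "dd (\<lambda>z. dd f (0, D *v snd z) z) h z =
      dd f (0, D *v snd h) z + (\<Sum>a\<in>UNIV. (D *v snd z) $ a * dd (dd f (0, axis a 1)) h z)"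
    unfolding * dd_vec_dir[OF f, of "D *v snd h"]
    by (subst dd_sum[OF h]) (simp add: dd_mult holo_matrix_coord holo_dd[OF f] dd_matrix_coord sum.distrib)
qed

text \<open>In the derivative along \<open>(0, v)\<close> of the coefficient linear in \<open>v\<close>, the third derivative of \<open>\<eta>\<close> is
parallel to \<open>v\<close> by the quadratic coefficient, and \<open>\<xi>\<^sub>v\<^sub>v = 0\<close> by the cubic one. What remains says that
\<open>\<xi>\<^sub>v D v\<close> is parallel to \<open>v\<close>.\<close>
lemma xi_independent_of_x:
  fixes Q :: "('n::finite) vfield" and D :: "complex^'n^'n"
  defines "X \<equiv> \<lambda>z. fst (Q z)"
  assumes sym: "lie_symmetry (linear_system D) Q" and D: "D \<notin> scalar_matrices"
  shows "dd X (0, v) z = 0"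
proof (rule ccontr)
  assume nz: "dd X (0, v) z \<noteq> 0"
  define Y where "Y b z = snd (Q z) $ b" for b z
  note det = determining_equations[OF sym, folded X_def Y_def]
  note X = det(1) and Y = det(2)
  have "\<exists>\<mu>. D *v v = \<mu> *s v" if nz: "dd X (0, v) z \<noteq> 0" for v
  proof -
    let ?V = "(0, v)"
    \<comment> \<open>the holomorphic factor of \<open>v\<close>\<close>
    define A where "A z = dd (dd X T) T z + dd X (0, D *v snd z) z" for z
    have A: "holo A" unfolding A_def by (intro holo_add holo_dd holo_dd_matrix X)
    have "dd (\<lambda>z. 2 * dd (dd (Y b) T) ?V z) ?V z =
      dd (\<lambda>z. v $ b * A z + 2 * ((D *v snd z) $ b * dd X ?V z)) ?V z" for b
      using det(4)[of b v] by (simp add: A_def mult.assoc)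
    then have 1: "2 * dd (dd (dd (Y b) T) ?V) ?V z = v $ b * dd A ?V z + 2 * (D *v v) $ b * dd X ?V z" for b
      by (simp add: dd_cmult dd_add dd_mult holo_dd holo_add holo_cmult holo_mult holo_matrix_coord X Y A
          dd_matrix_coord det(6))
    have "dd (dd (dd (Y b) T) ?V) ?V = dd (dd (dd (Y b) ?V) ?V) T" for b
    proof -
      have "dd (dd (Y b) T) ?V = dd (dd (Y b) ?V) T" by (rule ext) (rule dd_commute[OF Y])
      moreover have "dd (dd (dd (Y b) ?V) T) ?V = dd (dd (dd (Y b) ?V) ?V) T"
        by (rule ext) (rule dd_commute[OF holo_dd[OF Y]])
      ultimately show ?thesis by (simp only:)
    qed
    moreover have "dd (dd (Y b) ?V) ?V = (\<lambda>z. (2 * v $ b) * dd (dd X T) ?V z)" for b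
      by (rule ext) (rule det(5))
    ultimately have "dd (dd (dd (Y b) T) ?V) ?V z = 2 * v $ b * dd (dd (dd X T) ?V) T z" for b
      by (simp only: dd_cmult[OF holo_dd[OF holo_dd[OF X]]])
    with 1 have "(D *v v) $ b * (2 * dd X ?V z) = v $ b * (4 * dd (dd (dd X T) ?V) T z - dd A ?V z)" for b
      by (simp add: algebra_simps)
    then have "D *v v = ((4 * dd (dd (dd X T) ?V) T z - dd A ?V z) / (2 * dd X ?V z)) *s v"
      using nz by (simp add: Finite_Cartesian_Product.vec_eq_iff field_simps)
    then show ?thesis ..
  qed
  then have "D \<in> scalar_matrices"
    using scalar_if_eigenvectors_off_hyperplane[of "\<lambda>v. dd X (0, v) z" v D] nz dd_add_dir[OF X, of "(0,
        _)" "(0, _)" z]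
    by (simp add: dd_vec_cscale[OF X])
  with D show False by simp
qed

text \<open>Without \<open>\<xi>\<^sub>x\<close>, the equations say that \<open>\<eta>\<close> is affine in \<open>x\<close> with a linear part whose \<open>t\<close>-derivative is
\<open>\<xi>\<^sub>t\<^sub>t / 2\<close> times the identity. The constant coefficient, differentiated along \<open>(0, v)\<close> and then along
\<open>t\<close>, becomes \<open>\<xi>\<^sub>t\<^sub>t\<^sub>t\<^sub>t v / 2 = 2 \<xi>\<^sub>t\<^sub>t D v\<close> for all \<open>v\<close>; as \<open>D\<close> is not scalar, \<open>\<xi>\<^sub>t\<^sub>t = 0\<close>. So all
coefficients except \<open>\<chi>\<close> are constant.\<close>
theorem linear_system_symmetry_form:
  fixes Q :: "('n::finite) vfield" and D :: "complex^'n^'n"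
  assumes sym: "lie_symmetry (linear_system D) Q" and D: "D \<notin> scalar_matrices"
  obtains \<alpha> c G x x' where
    "Q = (\<lambda>z. (\<alpha> + c * fst z, x (fst z) + G *v snd z))"
    "\<And>v. G *v (D *v v) = D *v (G *v v) + (2 * c) *s (D *v v)"
    "\<And>t b. ((\<lambda>t. x t $ b) has_field_derivative x' t $ b) (at t)"
    "\<And>t b. ((\<lambda>t. x' t $ b) has_field_derivative (D *v x t) $ b) (at t)"
proof -
  define X where "X z = fst (Q z)" for z
  define Y where "Y b z = snd (Q z) $ b" for b z
  note det = determining_equations[OF sym, folded X_def Y_def]
  note X = det(1) and Y = det(2)
  have Xv: "dd X (0, v) = (\<lambda>z. 0)" for v
    using xi_independent_of_x[OF sym D] by (simp add: X_def[abs_def] fun_eq_iff)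
  have XTv: "dd (dd X T) (0, v) z = 0" for v z
    by (subst dd_commute[OF X]) (simp add: Xv dd_const)
  have Yvv: "dd (dd (Y b) (0, v)) (0, v) z = 0" for b v z
    by (simp add: det(5) XTv)
  have Yvw: "dd (dd (Y b) (0, v)) (0, w) z = 0" for b v w z
  proof -
    have e: "(0, v + w) = (0 :: complex, v) + (0, w)" by simp
    have "dd (Y b) (0, v + w) = (\<lambda>z. dd (Y b) (0, v) z + dd (Y b) (0, w) z)"
      unfolding e by (rule ext) (rule dd_add_dir[OF Y])
    then have "dd (dd (Y b) (0, v + w)) (0, v + w) z
        = dd (dd (Y b) (0, v)) (0, w) z + dd (dd (Y b) (0, w)) (0, v) z"
      by (simp add: dd_add holo_dd Y, simp add: e dd_add_dir holo_dd Y Yvv del: add_Pair)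
    then show ?thesis
      using Yvv[of b "v + w" z] dd_commute[OF Y, of b "(0, w)" "(0, v)" z] by simp
  qed
  have YTv: "dd (dd (Y b) T) (0, v) = (\<lambda>z. (v $ b / 2) * dd (dd X T) T z)" for b v
  proof
    show "dd (dd (Y b) T) (0, v) z = (v $ b / 2) * dd (dd X T) T z" for z
      using det(4)[of b v z] by (simp add: Xv field_simps)
  qed
  have YvT: "dd (dd (Y b) (0, v)) T = (\<lambda>z. (v $ b / 2) * dd (dd X T) T z)" for b v
    unfolding YTv[symmetric] by (rule ext) (rule dd_commute[OF Y])
  have E: "v $ b / 2 * dd (dd (dd X T) T) T z + dd (Y b) (0, D *v v) z - 2 * (D *v v) $ b * dd X T z
      = (\<Sum>a\<in>UNIV. D $ b $ a * dd (Y a) (0, v) z)" for b v z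
  proof -
    have "dd (\<lambda>z. dd (dd (Y b) T) T z + dd (Y b) (0, D *v snd z) z
        - 2 * ((D *v snd z) $ b * dd X T z)) (0, v) z
       = dd (\<lambda>z. \<Sum>a\<in>UNIV. D $ b $ a * Y a z) (0, v) z"
      using det(3)[of b] by (simp add: mult.assoc)
    moreover have "dd (dd (dd (Y b) T) T) (0, v) z = v $ b / 2 * dd (dd (dd X T) T) T z"
      by (subst dd_commute[OF holo_dd[OF Y]]) (simp only: YTv dd_cmult[OF holo_dd[OF holo_dd[OF X]]])
    ultimately show ?thesis
      by (simp add: dd_add dd_diff dd_cmult dd_mult dd_sum holo_add holo_diff holo_dd holo_cmult
          holo_mult holo_sum
          holo_matrix_coord dd_matrix_coord holo_dd_matrix dd_dd_matrix X Y Yvw XTv mult.assoc)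
  qed
  have XTT: "dd (dd X T) T z = 0" for z
  proof (rule ccontr)
    assume nz: "dd (dd X T) T z \<noteq> 0"
    have "D *v v = (dd (dd (dd (dd X T) T) T) T z / (4 * dd (dd X T) T z)) *s v" for v
    proof -
      have "(D *v v) $ b * (4 * dd (dd X T) T z) = dd (dd (dd (dd X T) T) T) T z * v $ b" for b
      proof -
        have "dd (\<lambda>z. v $ b / 2 * dd (dd (dd X T) T) T z + dd (Y b) (0, D *v v) z
            - 2 * (D *v v) $ b * dd X T z) T z
          = dd (\<lambda>z. \<Sum>a\<in>UNIV. D $ b $ a * dd (Y a) (0, v) z) T z"
          by (rule arg_cong[of _ _ "\<lambda>f. dd f T z"], rule ext, rule E)
        then have "v $ b / 2 * dd (dd (dd (dd X T) T) T) T z + (D *v v) $ b / 2 * dd (dd X T) T z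
            - 2 * (D *v v) $ b * dd (dd X T) T z
          = (\<Sum>a\<in>UNIV. D $ b $ a * (v $ a / 2 * dd (dd X T) T z))"
          by (simp only: dd_add dd_diff dd_cmult dd_sum holo_add holo_diff holo_dd holo_cmult X Y YvT)
        also have "\<dots> = (D *v v) $ b / 2 * dd (dd X T) T z"
          by (simp add: matrix_vector_mult_def sum_distrib_left sum_distrib_right sum_divide_distrib mult_ac)
        finally show ?thesis by (simp add: field_simps)
      qed
      then show ?thesis
        using nz by (simp add: Finite_Cartesian_Product.vec_eq_iff field_simps)
    qed
    then have "D \<in> scalar_matrices" by (rule scalar_matrixI)
    with D show False ..
  qed
  have const: "f z = f 0" if f: "holo f" and 0: "\<And>z. dd f T z = 0" "\<And>v z. dd f (0, v) z = 0"
      for f :: "complex \<times> (complex^'n) \<Rightarrow> complex" and z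
  proof -
    have "dd f z z' = 0" for z'
      using dd_pair_dir[OF f, of "fst z" "snd z" z'] by (simp add: 0)
    from dd_zero_imp_eq[OF f this, of 0] show ?thesis by simp
  qed
  define c where "c = dd X T 0"
  define G :: "complex^'n^'n" where "G = (\<chi> b a. dd (Y b) (0, axis a 1) 0)"
  define x :: "complex \<Rightarrow> complex^'n" where "x t = (\<chi> b. Y b (t, 0))" for t
  define x' :: "complex \<Rightarrow> complex^'n" where "x' t = (\<chi> b. dd (Y b) T (t, 0))" for t
  have XT: "dd X T z = c" for z
    unfolding c_def by (rule const) (auto simp: holo_dd X XTT XTv)
  have Yv: "dd (Y b) (0, v) z = (G *v v) $ b" for b v z
  proof -
    have "dd (Y b) (0, v) z = dd (Y b) (0, v) 0"
      by (rule const) (auto simp: holo_dd Y Yvw YvT XTT)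
    also have "\<dots> = (G *v v) $ b"
      by (subst dd_vec_dir[OF Y]) (simp add: G_def matrix_vector_mult_def mult.commute)
    finally show ?thesis .
  qed
  have X_eq: "X z = X 0 + c * fst z" for z
  proof -
    have "X z - c * fst z = X 0 - c * fst (0 :: complex \<times> (complex^'n))"
      by (rule const) (simp_all add: holo_diff holo_cmult holo_fst X dd_diff dd_cmult dd_fst XT Xv)
    then show ?thesis by (simp add: algebra_simps)
  qed
  have Y_eq: "Y b (t, v) = (x t + G *v v) $ b" for b t v
  proof -
    have "Y b ((t, 0) + (0, v)) - (G *v snd ((t, 0) + (0, v))) $ b
        = Y b (t, 0) - (G *v snd (t, 0 :: complex^'n)) $ b"
      by (rule dd_zero_imp_eq)
        (simp_all add: holo_diff holo_matrix_coord Y dd_diff dd_matrix_coord Yv)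
    then show ?thesis by (simp add: x_def algebra_simps)
  qed
  show ?thesis
  proof
    show "Q = (\<lambda>z. (X 0 + c * fst z, x (fst z) + G *v snd z))"
    proof
      show "Q z = (X 0 + c * fst z, x (fst z) + G *v snd z)" for z
        using X_eq[of z] Y_eq[of _ "fst z" "snd z"]
        by (simp add: X_def Y_def prod_eq_iff Finite_Cartesian_Product.vec_eq_iff)
    qed
    show "G *v (D *v v) = D *v (G *v v) + (2 * c) *s (D *v v)" for v
    proof -
      have "dd (dd X T) T = (\<lambda>z. 0)"
        by (rule ext) (rule XTT)
      then have "dd (dd (dd X T) T) T z = 0" for z
        by (simp only: dd_const)
      from E[of v _ 0, unfolded this Yv XT]
      have "(G *v (D *v v)) $ i - 2 * (D *v v) $ i * c = (D *v (G *v v)) $ i" for i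
        by (simp add: matrix_vector_mult_def[of D "G *v _"])
      then show ?thesis
        by (simp add: Finite_Cartesian_Product.vec_eq_iff algebra_simps)
    qed
    show "((\<lambda>t. x t $ b) has_field_derivative x' t $ b) (at t)" for t b
      using dd_t_dir[OF Y, of b 0 t] by (simp add: x_def x'_def)
    show "((\<lambda>t. x' t $ b) has_field_derivative (D *v x t) $ b) (at t)" for t b
    proof -
      have "dd (dd (Y b) T) T (t, 0) = (D *v x t) $ b"
        using det(3)[of b "(t, 0)"] dd_0_dir[OF Y, of b] 
        by (simp add: matrix_vector_mult_def[of D "\<chi> b. Y b (t, 0)"] x_def zero_prod_def)
      then show ?thesis
        using dd_t_dir[OF holo_dd[OF Y], of b T 0 t] by (simp add: x'_def)
    qed
  qed
qed

lemma holo_of_t: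
  fixes z :: "complex \<times> (complex^'n::finite)"
  assumes g: "\<And>t. (g has_field_derivative g' t) (at t)"
  shows "holo (\<lambda>z :: complex \<times> (complex^'n). g (fst z))" and "dd (\<lambda>z. g (fst z)) h z = fst h * g' (fst z)"
proof -
  have *: "((\<lambda>z. g (fst z)) has_derivative (\<lambda>h. fst h * g' (fst z))) (at z)" for z :: "complex \<times> (complex^'n)"
    using has_derivative_compose[OF has_derivative_fst[OF has_derivative_ident] g[unfolded
        has_field_derivative_def], of z UNIV]
    by (simp add: mult.commute)
  show "holo (\<lambda>z :: complex \<times> (complex^'n). g (fst z))"
    by (rule holoI[OF *]) (simp add: cscale_def)
  show "dd (\<lambda>z. g (fst z)) h z = fst h * g' (fst z)"
    by (rule dd_unique[OF *]) (simp add: cscale_def)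
qed

theorem linear_system_symmetryI:
  fixes D G :: "complex^'n^'n::finite"
  assumes G: "\<And>v. G *v (D *v v) = D *v (G *v v) + (2 * c) *s (D *v v)"
    and x: "\<And>t b. ((\<lambda>t. x t $ b) has_field_derivative x' t $ b) (at t)"
    and x': "\<And>t b. ((\<lambda>t. x' t $ b) has_field_derivative (D *v x t) $ b) (at t)"
  shows "lie_symmetry (linear_system D) (\<lambda>z. (\<alpha> + c * fst z, x (fst z) + G *v snd z))"
proof -
  let ?X = "\<lambda>z :: complex \<times> (complex^'n). \<alpha> + c * fst z"
  let ?Y = "\<lambda>b (z :: complex \<times> (complex^'n)). x (fst z) $ b + (G *v snd z) $ b"
  have X: "holo ?X" and Y: "holo (?Y b)" for b
    by (intro holo_add holo_const holo_cmult holo_fst holo_of_t(1)[OF x] holo_matrix_coord)+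
  have dX: "dd ?X h = (\<lambda>z. c * fst h)" for h
    by (rule ext) (simp add: dd_add dd_cmult dd_const dd_fst holo_const holo_cmult holo_fst)
  have dY: "dd (?Y b) h = (\<lambda>z. fst h * x' (fst z) $ b + (G *v snd h) $ b)" for b h
    by (rule ext) (simp add: dd_add holo_of_t[OF x] holo_matrix_coord dd_matrix_coord)
  have ddY: "dd (dd (?Y b) h) k z = fst h * (fst k * (D *v x (fst z)) $ b)" for b h k z
    unfolding dY by (simp add: dd_add dd_cmult dd_const holo_const holo_cmult holo_of_t[OF x'])
  have "(G *v (D *v y)) $ b = (D *v (G *v y)) $ b + 2 * c * (D *v y) $ b" for y b
    unfolding G by simp
  then show ?thesis
    unfolding lie_symmetry_linear_iff fst_conv snd_conv vector_add_component
    by (simp add: X Y ddY) (simp add: dX dY dd_const matrix_vector_mult_def[of D "x _"]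
        matrix_vector_mult_def[of D "G *v _"] sum.distrib algebra_simps)
qed

section \<open>The dimension of the space of parameters\<close>

text \<open>The bilinear pairing of a row vector with a column vector; unlike the Hermitian product it involves no
complex conjugation.\<close>

definition dotp :: "complex^'n \<Rightarrow> complex^'n \<Rightarrow> complex" where
  "dotp q p = (\<Sum>i\<in>UNIV. q $ i * p $ i)"

lemma dotp_simps [simp]:
  fixes q r :: "complex^'n::finite"
  shows "dotp q (x + y) = dotp q x + dotp q y" "dotp q (x - y) = dotp q x - dotp q y" "dotp q (c *s x)
      = c * dotp q x"
    "dotp (q + r) x = dotp q x + dotp r x" "dotp (q - r) x = dotp q x - dotp r x" "dotp (c *s q) x
        = c * dotp q x"
    "dotp q 0 = 0" "dotp 0 x = 0"
  by (simp_all add: dotp_def sum.distrib sum_subtractf sum_distrib_left algebra_simps)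

lemma dotp_minus [simp]: "dotp q (- x) = - dotp (q :: complex^'n::finite) x"
  by (simp add: dotp_def sum_negf)

lemma dotp_axis [simp]: "dotp q (axis i c) = c * q $ i" "dotp (axis i c) (q :: complex^'n::finite)
    = c * q $ i"
  by (simp_all add: dotp_def axis_def if_distrib if_distribR mult.commute[of _ c] cong: if_cong)

lemma dotp_transfer: "dotp (q v* D) x = dotp q (D *v (x :: complex^'n::finite))"
  unfolding dotp_def vector_matrix_mult_def matrix_vector_mult_def
  by (simp add: sum_distrib_left sum_distrib_right mult_ac) (rule sum.swap)

definition outer :: "complex^'n \<Rightarrow> complex^'n \<Rightarrow> complex^'n^'n" where
  "outer p q = (\<chi> i j. p $ i * q $ j)"

lemma outer_mult_vec [simp]: "outer p q *v x = dotp q (x :: complex^'n::finite) *s p"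
  by (simp add: outer_def dotp_def matrix_vector_mult_def Finite_Cartesian_Product.vec_eq_iff
      sum_distrib_left sum_distrib_right mult_ac)

text \<open>Otherwise \<open>\<phi> u = 0\<close> implies \<open>\<phi> D u = 0\<close>. Unit vectors \<open>\<phi>\<close> and \<open>u\<close> then show that \<open>D\<close> is diagonal, and
\<open>\<phi> = e\<^sub>i - e\<^sub>j\<close>, \<open>u = e\<^sub>i + e\<^sub>j\<close> that its diagonal entries are equal.\<close>
lemma nonscalar_witness:
  fixes D :: "complex^'n^'n::finite"
  assumes D: "D \<notin> scalar_matrices"
  obtains u \<phi> where "dotp \<phi> u = 0" "dotp \<phi> (D *v u) = 1"
proof -
  have col: "D *v axis j c = (\<chi> i. c * D $ i $ j)" for j c
    by (simp add: matrix_vector_mult_def axis_def Finite_Cartesian_Product.vec_eq_iff if_distrib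
        mult.commute cong: if_cong)
  have "\<exists>u \<phi>. dotp \<phi> u = 0 \<and> dotp \<phi> (D *v u) \<noteq> 0"
  proof (rule ccontr)
    assume "\<not> ?thesis"
    then have H: "dotp \<phi> (D *v u) = 0" if "dotp \<phi> u = 0" for \<phi> u
      using that by blast
    have off: "D $ i $ j = 0" if "i \<noteq> j" for i j
      using H[of "axis i 1" "axis j 1"] that by (simp add: col) (simp add: axis_def)
    have diag: "D $ i $ i = D $ j $ j" for i j
    proof (cases "i = j")
      case False
      then have "dotp (axis i 1 - axis j 1) (axis i 1 + axis j 1) = 0"
        by simp (simp add: axis_def)
      from H[OF this] show ?thesis
        using off[of i j] off[of j i] False by (simp add: matrix_vector_right_distrib col)
    qed simp
    have "D = Finite_Cartesian_Product.mat (D $ undefined $ undefined)"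
      using off diag by (auto simp: Finite_Cartesian_Product.mat_def Finite_Cartesian_Product.vec_eq_iff)
    with D show False unfolding scalar_matrices_def by blast
  qed
  then obtain u \<phi> where "dotp \<phi> u = 0" "dotp \<phi> (D *v u) \<noteq> 0" by blast
  then show thesis
    by (intro that[of "(1 / dotp \<phi> (D *v u)) *s \<phi>" u]) auto
qed

text \<open>The coordinates of \<open>(\<Gamma>, \<chi>(0), \<chi>'(0), \<alpha>)\<close>, put into a single vector in order to have a space with a
dimension over \<open>\<complex>\<close> at hand.\<close>
type_synonym 'n params = "complex^('n \<times> 'n + ('n + 'n) + unit)"

definition mat_part :: "('n::finite) params \<Rightarrow> complex^'n^'n" where
  "mat_part g = (\<chi> i j. g $ Inl (i, j))"

definition of_mat_part :: "complex^'n^'n \<Rightarrow> ('n::finite) params" where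
  "of_mat_part A = (\<chi> k. case k of Inl (i, j) \<Rightarrow> A $ i $ j | Inr _ \<Rightarrow> 0)"

text \<open>Here \<open>c\<close> stands for twice the coefficient of \<open>t\<close> in \<open>\<xi>\<close>. It is not a coordinate of its own because it is
determined by the matrix part when \<open>D \<noteq> 0\<close>. The other coordinates are unrestricted.\<close>
definition sym_params :: "complex^'n^'n \<Rightarrow> ('n::finite) params set" where
  "sym_params D = {g. \<exists>c. \<forall>x. mat_part g *v (D *v x) = D *v (mat_part g *v x) + c *s (D *v x)}"

lemma mat_part_of [simp]: "mat_part (of_mat_part A) = A"
  by (simp add: mat_part_def of_mat_part_def Finite_Cartesian_Product.vec_eq_iff)

lemma mat_part_mult [simp]:
  "mat_part 0 *v x = 0" "mat_part (g + h) *v x = mat_part g *v x + mat_part h *v x"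
  "mat_part (g - h) *v x = mat_part g *v x - mat_part h *v x" "mat_part (c *s g) *v x
      = c *s (mat_part g *v x)"
  by (simp_all add: mat_part_def matrix_vector_mult_def Finite_Cartesian_Product.vec_eq_iff sum.distrib
      sum_subtractf sum_distrib_left algebra_simps)

lemma of_mat_part_eqI: "mat_part g = A \<Longrightarrow> (\<And>k. g $ Inr k = 0) \<Longrightarrow> g = of_mat_part A"
  by (auto simp: mat_part_def of_mat_part_def Finite_Cartesian_Product.vec_eq_iff split: sum.split)

lemma of_mat_part_linear:
  "of_mat_part (outer (p + p') q) = of_mat_part (outer p q) + of_mat_part (outer p' q)"
  "of_mat_part (outer p (q + q')) = of_mat_part (outer p q) + of_mat_part (outer p q')"
  "of_mat_part (outer (c *s p) q) = c *s of_mat_part (outer p q)"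
  "of_mat_part (outer p (c *s q)) = c *s of_mat_part (outer p q)"
  by (auto simp: of_mat_part_def outer_def Finite_Cartesian_Product.vec_eq_iff algebra_simps split: sum.split)

lemma subspace_sym_params: "vec.subspace (sym_params D)"
  unfolding vec.subspace_def
proof (intro conjI ballI allI)
  show "0 \<in> sym_params D" unfolding sym_params_def by (auto intro!: exI[of _ 0])
next
  fix g h assume "g \<in> sym_params D" "h \<in> sym_params D"
  then obtain c d where "\<And>x. mat_part g *v (D *v x) = D *v (mat_part g *v x) + c *s (D *v x)"
    "\<And>x. mat_part h *v (D *v x) = D *v (mat_part h *v x) + d *s (D *v x)"
    unfolding sym_params_def by blast
  then show "g + h \<in> sym_params D"
    unfolding sym_params_def by (auto intro!: exI[of _ "c + d"]
        simp: matrix_vector_right_distrib vec.scale_left_distrib)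
next
  fix k g assume "g \<in> sym_params D"
  then obtain c where "\<And>x. mat_part g *v (D *v x) = D *v (mat_part g *v x) + c *s (D *v x)"
    unfolding sym_params_def by blast
  then show "k *s g \<in> sym_params D"
    unfolding sym_params_def by (auto intro!: exI[of _ "k * c"]
        simp: vector_scalar_commute vec.scale_right_distrib)
qed

text \<open>The space \<open>W\<close> of the matrices \<open>p \<phi> + u \<psi>\<close>. Its intersection with \<open>sym_params D\<close> is small when
\<open>\<phi> u = 0\<close> and \<open>\<phi> D u = 1\<close>, which bounds \<open>sym_params D\<close> from above.\<close>
definition probe :: "complex^'n \<Rightarrow> complex^'n \<Rightarrow> ('n::finite) params set" where
  "probe u \<phi> = {x + y | x y. x \<in> range (\<lambda>p. of_mat_part (outer p \<phi>))
      \<and> y \<in> range (\<lambda>\<psi>. of_mat_part (outer u \<psi>))}"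

lemma probeE:
  assumes "g \<in> probe u \<phi>"
  obtains p \<psi> where "g = of_mat_part (outer p \<phi>) + of_mat_part (outer u \<psi>)"
    "\<And>x. mat_part g *v x = dotp \<phi> x *s p + dotp \<psi> x *s u"
  using assms unfolding probe_def by auto

lemma linear_outer:
  "Vector_Spaces.linear (*s) (*s) (\<lambda>p. of_mat_part (outer p \<phi>))"
  "Vector_Spaces.linear (*s) (*s) (\<lambda>\<psi>. of_mat_part (outer u \<psi>))"
  by (unfold_locales) (simp_all add: of_mat_part_linear)

lemma subspace_probe: "vec.subspace (probe u \<phi>)"
  unfolding probe_def
  by (intro vec.subspace_sums vec.linear_subspace_image linear_outer vec.subspace_UNIV)

text \<open>Both summands have dimension \<open>n\<close>, and they meet in the multiples of \<open>u \<phi>\<close>.\<close>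
lemma dim_probe:
  fixes u \<phi> :: "complex^'n::finite"
  assumes "u \<noteq> 0" "\<phi> \<noteq> 0"
  shows "vec.dim (probe u \<phi>) + 1 = 2 * CARD('n)"
proof -
  let ?A = "range (\<lambda>p. of_mat_part (outer p \<phi>))" and ?B = "range (\<lambda>\<psi>. of_mat_part (outer u \<psi>))"
  obtain i where i: "u $ i \<noteq> 0" using assms(1) by (auto simp: Finite_Cartesian_Product.vec_eq_iff)
  obtain j where j: "\<phi> $ j \<noteq> 0" using assms(2) by (auto simp: Finite_Cartesian_Product.vec_eq_iff)
  have entry: "of_mat_part A = of_mat_part B \<longleftrightarrow> A = B" for A B :: "complex^'n^'n"
    by (metis mat_part_of)
  have "inj (\<lambda>p. of_mat_part (outer p \<phi>))"
    using j by (intro injI, simp only: entry) (auto simp: outer_def Finite_Cartesian_Product.vec_eq_iff)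
  then have A: "vec.dim ?A = CARD('n)"
    by (subst vec.dim_image_eq[OF linear_outer(1)]) (simp_all add: vec.dim_UNIV card_cart_basis)
  have "inj (\<lambda>\<psi>. of_mat_part (outer u \<psi>))"
    using i by (intro injI, simp only: entry) (auto simp: outer_def Finite_Cartesian_Product.vec_eq_iff)
  then have B: "vec.dim ?B = CARD('n)"
    by (subst vec.dim_image_eq[OF linear_outer(2)]) (simp_all add: vec.dim_UNIV card_cart_basis)
  have "?A \<inter> ?B = vec.span {of_mat_part (outer u \<phi>)}"
  proof
    show "vec.span {of_mat_part (outer u \<phi>)} \<subseteq> ?A \<inter> ?B"
      by (auto simp: vec.span_singleton simp flip: of_mat_part_linear(3)) (simp add:
          of_mat_part_linear(3) flip: of_mat_part_linear(4))
    show "?A \<inter> ?B \<subseteq> vec.span {of_mat_part (outer u \<phi>)}"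
    proof
      fix g assume "g \<in> ?A \<inter> ?B"
      then obtain p \<psi> where g: "g = of_mat_part (outer p \<phi>)" "outer p \<phi> = outer u \<psi>"
        by (auto simp: entry)
      have "p $ k * \<phi> $ j = u $ k * \<psi> $ j" for k
        using g(2) by (simp add: outer_def Finite_Cartesian_Product.vec_eq_iff)
      then have "p = (\<psi> $ j / \<phi> $ j) *s u"
        using j by (simp add: Finite_Cartesian_Product.vec_eq_iff field_simps)
      then show "g \<in> vec.span {of_mat_part (outer u \<phi>)}"
        unfolding g(1) by (auto simp: of_mat_part_linear(3) vec.span_singleton)
    qed
  qed
  moreover have "of_mat_part (outer u \<phi>) \<noteq> 0"
  proof
    assume "of_mat_part (outer u \<phi>) = 0"
    then have "of_mat_part (outer u \<phi>) $ Inl (i, j) = 0" by simp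
    with i j show False by (simp add: of_mat_part_def outer_def)
  qed
  ultimately have "vec.dim (?A \<inter> ?B) = 1"
    by (simp add: vec.dim_span_eq_card_independent)
  moreover have "vec.dim (probe u \<phi>) + vec.dim (?A \<inter> ?B) = vec.dim ?A + vec.dim ?B"
    unfolding probe_def by (intro vec.dim_sums_Int vec.linear_subspace_image linear_outer vec.subspace_UNIV)
  ultimately show ?thesis using A B by simp
qed

text \<open>The numbers \<open>\<phi> \<Gamma> D u\<close> and \<open>\<phi> D \<Gamma> u\<close>, which separate the elements of the intersection of \<open>probe u \<phi>\<close>
with \<open>sym_params D\<close>.\<close>
definition probe_coords :: "complex^'n^'n \<Rightarrow> complex^'n \<Rightarrow> complex^'n \<Rightarrow> ('n::finite) params \<Rightarrow> complex^bool"
    where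
  "probe_coords D u \<phi> g = (\<chi> i. if i then dotp \<phi> (mat_part g *v (D *v u)) else dotp \<phi> (D *v (mat_part g
      *v u)))"

lemma linear_probe_coords: "Vector_Spaces.linear (*s) (*s) (probe_coords D u \<phi>)"
  by unfold_locales
    (auto simp: probe_coords_def Finite_Cartesian_Product.vec_eq_iff matrix_vector_right_distrib
        vector_scalar_commute)

text \<open>Evaluating \<open>\<Gamma> D - D \<Gamma> = c D\<close> at \<open>u\<close> expresses \<open>p\<close>, and applying \<open>\<phi>\<close> to it expresses \<open>\<psi>\<close>; only
\<open>c\<close>, \<open>a = \<psi> u\<close> and one further number \<open>e\<close> remain free.\<close>
lemma probe_Int_sym_params_form:
  fixes D :: "complex^'n^'n::finite"
  assumes \<phi>: "dotp \<phi> u = 0" "dotp \<phi> (D *v u) = 1"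
    and g: "g \<in> sym_params D" "g \<in> probe u \<phi>"
  obtains c a e where "\<And>x. mat_part g *v x = ((c + a) * dotp \<phi> x) *s (D *v u) + (a * dotp \<phi> (D *v x)
      + e * dotp \<phi> x) *s u"
    "\<And>x. mat_part g *v (D *v x) = D *v (mat_part g *v x) + c *s (D *v x)"
    "probe_coords D u \<phi> g $ True = c + a" "probe_coords D u \<phi> g $ False = a"
proof -
  obtain c where c: "\<And>x. mat_part g *v (D *v x) = D *v (mat_part g *v x) + c *s (D *v x)"
    using g(1) unfolding sym_params_def by blast
  obtain p \<psi> where G: "\<And>x. mat_part g *v x = dotp \<phi> x *s p + dotp \<psi> x *s u"
    using g(2) by (rule probeE) blast
  have E: "dotp \<phi> (D *v x) *s p + dotp \<psi> (D *v x) *s u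
      = dotp \<phi> x *s (D *v p) + dotp \<psi> x *s (D *v u) + c *s (D *v x)" for x
    using c[of x] unfolding G matrix_vector_right_distrib vector_scalar_commute .
  define a where "a = dotp \<psi> u"
  have p: "p = (c + a) *s (D *v u) - dotp \<psi> (D *v u) *s u"
    using E[of u] by (simp add: \<phi> a_def Finite_Cartesian_Product.vec_eq_iff algebra_simps)
  have "dotp \<phi> p = c + a"
    by (subst p) (simp add: \<phi>)
  then have \<psi>: "dotp \<psi> x = a * dotp \<phi> (D *v x) - dotp \<phi> (D *v p) * dotp \<phi> x" for x
    using arg_cong[OF E[of x], of "dotp \<phi>"] by (simp add: \<phi> algebra_simps)
  have G': "mat_part g *v x = ((c + a) * dotp \<phi> x) *s (D *v u)
      + (a * dotp \<phi> (D *v x) + (- dotp \<psi> (D *v u) - dotp \<phi> (D *v p)) * dotp \<phi> x) *s u" for x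
    unfolding G \<psi>[of x] by (subst p) (simp add: Finite_Cartesian_Product.vec_eq_iff algebra_simps)
  show thesis
  proof (rule that[OF G' c])
    show "probe_coords D u \<phi> g $ True = c + a" "probe_coords D u \<phi> g $ False = a"
      unfolding probe_coords_def by (simp_all add: G' \<phi> vector_scalar_commute)
  qed
qed

text \<open>If both coordinates vanish, the matrix is \<open>e u \<phi>\<close>, and the relation at \<open>u\<close> becomes \<open>e u = 0\<close>.\<close>
lemma dim_probe_Int_sym_params:
  fixes D :: "complex^'n^'n::finite"
  assumes \<phi>: "dotp \<phi> u = 0" "dotp \<phi> (D *v u) = 1"
  shows "vec.dim (sym_params D \<inter> probe u \<phi>) = vec.dim (probe_coords D u \<phi> ` (sym_params D \<inter> probe u \<phi>))"
proof -
  let ?K = "sym_params D \<inter> probe u \<phi>"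
  have sub: "vec.subspace ?K" by (intro vec.subspace_inter subspace_sym_params subspace_probe)
  have "u \<noteq> 0" using \<phi>(2) by auto
  have "g = 0" if g: "g \<in> ?K" and 0: "probe_coords D u \<phi> g = 0" for g
  proof -
    from g obtain c a e where
      G: "\<And>x. mat_part g *v x = ((c + a) * dotp \<phi> x) *s (D *v u) + (a * dotp \<phi> (D *v x) + e * dotp \<phi> x) *s u"
      and c: "\<And>x. mat_part g *v (D *v x) = D *v (mat_part g *v x) + c *s (D *v x)"
      and co: "probe_coords D u \<phi> g $ True = c + a" "probe_coords D u \<phi> g $ False = a"
      using probe_Int_sym_params_form[OF \<phi>, of g] by (metis IntE)
    have z: "c = 0" "a = 0" using co 0 by auto
    have "e *s u = 0" using c[of u] unfolding G by (simp add: z \<phi>)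
    then have "e = 0" using \<open>u \<noteq> 0\<close> by simp
    have "mat_part g *v x = 0 *v x" for x unfolding G by (simp add: z \<open>e = 0\<close>)
    then have mg: "mat_part g = 0" by (simp add: matrix_eq)
    obtain p \<psi> where "g = of_mat_part (outer p \<phi>) + of_mat_part (outer u \<psi>)"
      using g by (auto elim: probeE)
    then have "g $ Inr k = 0" for k by (simp add: of_mat_part_def)
    with mg have "g = of_mat_part 0" by (intro of_mat_part_eqI)
    then show "g = 0" by (auto simp: of_mat_part_def Finite_Cartesian_Product.vec_eq_iff split: sum.split)
  qed
  then have "inj_on (probe_coords D u \<phi>) ?K"
    using vec.linear_inj_on_iff_eq_0[OF linear_probe_coords sub] by blast
  then show ?thesis
    by (subst vec.dim_image_eq[OF linear_probe_coords]) (simp_all add: vec.span_eq_iff[THEN iffD2, OF sub])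
qed

lemma dim_sym_params_eq:
  fixes D :: "complex^'n^'n::finite"
  assumes \<phi>: "dotp \<phi> u = 0" "dotp \<phi> (D *v u) = 1"
  shows "vec.dim {x + y | x y. x \<in> sym_params D \<and> y \<in> probe u \<phi>} + vec.dim (sym_params D \<inter> probe u \<phi>) + 1
    = vec.dim (sym_params D) + 2 * CARD('n)"
proof -
  have "u \<noteq> 0" "\<phi> \<noteq> 0" using \<phi>(2) by auto
  from dim_probe[OF this] vec.dim_sums_Int[OF subspace_sym_params subspace_probe, of D u \<phi>]
  show ?thesis by simp
qed

lemma CARD_params: "CARD('n \<times> 'n + ('n + 'n) + unit) = CARD('n::finite)^2 + 2 * CARD('n) + 1"
  by (simp add: power2_eq_square)

text \<open>The zero matrix is included.\<close>
definition rank_one_nilpotent :: "complex^'n^'n \<Rightarrow> bool" where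
  "rank_one_nilpotent D \<longleftrightarrow> (\<exists>p q. D = outer p q \<and> dotp q p = 0)"

text \<open>In the case of equality the two coordinates on the intersection take all values. The element \<open>g\<close> with
\<open>c = 1\<close>, \<open>a = 0\<close> expresses \<open>D\<close> by \<open>D u\<close>, \<open>D\<^sup>2 u\<close> and \<open>\<phi> D\<close>; together with the element \<open>h\<close> with
\<open>c = 0\<close>, \<open>a = 1\<close> it forces \<open>D\<^sup>2 u = 0\<close>.\<close>
theorem dim_sym_params_le:
  fixes D :: "complex^'n^'n::finite"
  assumes D: "D \<notin> scalar_matrices"
  shows "vec.dim (sym_params D) \<le> CARD('n)^2 + 4"
    and "vec.dim (sym_params D) = CARD('n)^2 + 4 \<Longrightarrow> rank_one_nilpotent D"
proof -
  obtain u \<phi> where \<phi>: "dotp \<phi> u = 0" "dotp \<phi> (D *v u) = 1"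
    using nonscalar_witness[OF D] .
  let ?K = "sym_params D \<inter> probe u \<phi>"
  let ?P = "probe_coords D u \<phi> ` ?K"
  have dims: "vec.dim S \<le> CARD('m)" for S :: "(complex^'m::finite) set"
    using vec.dim_subset_UNIV[of S] by (simp add: card_cart_basis vec.dimension_def)
  have b1: "vec.dim {x + y | x y. x \<in> sym_params D \<and> y \<in> probe u \<phi>} \<le> CARD('n)^2 + 2 * CARD('n) + 1"
    using dims[of "{x + y | x y. x \<in> sym_params D \<and> y \<in> probe u \<phi>}"] unfolding CARD_params .
  have b2: "vec.dim ?P \<le> 2" using dims[of ?P] by simp
  show "vec.dim (sym_params D) \<le> CARD('n)^2 + 4"
    using dim_sym_params_eq[OF \<phi>] dim_probe_Int_sym_params[OF \<phi>] b1 b2 by linarith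
  assume "vec.dim (sym_params D) = CARD('n)^2 + 4"
  then have "vec.dim ?P = 2"
    using dim_sym_params_eq[OF \<phi>] dim_probe_Int_sym_params[OF \<phi>] b1 b2 by linarith
  then have "vec.span ?P = UNIV"
    using vec.dim_eq_full[of ?P] by (simp add: vec.dimension_def card_cart_basis)
  moreover have "vec.subspace ?P"
    by (intro vec.linear_subspace_image linear_probe_coords vec.subspace_inter subspace_sym_params
        subspace_probe)
  ultimately have P: "?P = UNIV" by (simp add: vec.span_eq_iff[THEN iffD2])
  have ex: "\<exists>g e. (\<forall>x. mat_part g *v x = ((c + a) * dotp \<phi> x) *s (D *v u) + (a * dotp \<phi> (D *v x)
      + e * dotp \<phi> x) *s u)
     \<and> (\<forall>x. mat_part g *v (D *v x) = D *v (mat_part g *v x) + c *s (D *v x))" for c a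
  proof -
    have "(\<chi> i. if i then c + a else a) \<in> ?P" unfolding P by simp
    then obtain g where g: "g \<in> sym_params D" "g \<in> probe u \<phi>" "probe_coords D u \<phi> g
        = (\<chi> i. if i then c + a else a)"
      by auto
    obtain c' a' e where
      G: "\<And>x. mat_part g *v x = ((c' + a') * dotp \<phi> x) *s (D *v u) + (a' * dotp \<phi> (D *v x)
          + e * dotp \<phi> x) *s u"
      "\<And>x. mat_part g *v (D *v x) = D *v (mat_part g *v x) + c' *s (D *v x)"
      and co: "probe_coords D u \<phi> g $ True = c' + a'" "probe_coords D u \<phi> g $ False = a'"
      by (rule probe_Int_sym_params_form[OF \<phi> g(1,2)]) (rule that)
    have "a' = a" "c' = c" using co by (simp_all add: g(3))
    with G show ?thesis by (intro exI[of _ g] exI[of _ e] conjI allI) (simp_all only:)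
  qed
  let ?w = "D *v u" let ?ww = "D *v (D *v u)"
  obtain g e where
    "(\<forall>x. mat_part g *v x = ((1 + 0) * dotp \<phi> x) *s ?w + (0 * dotp \<phi> (D *v x) + e * dotp \<phi> x) *s u)
      \<and> (\<forall>x. mat_part g *v (D *v x) = D *v (mat_part g *v x) + 1 *s (D *v x))"
    using ex[of 1 0] by (elim exE) (rule that)
  note g = this[unfolded mult_zero_left add_0 add_0_right mult_1 vec.scale_one, THEN conjunct1, THEN spec]
    this[unfolded mult_zero_left add_0 add_0_right mult_1 vec.scale_one, THEN conjunct2, THEN spec]
  obtain h k where
    "(\<forall>x. mat_part h *v x = ((0 + 1) * dotp \<phi> x) *s ?w + (1 * dotp \<phi> (D *v x) + k * dotp \<phi> x) *s u)
      \<and> (\<forall>x. mat_part h *v (D *v x) = D *v (mat_part h *v x) + 0 *s (D *v x))"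
    using ex[of 0 1] by (elim exE) (rule that)
  note h = this[unfolded add_0 add_0_right mult_1 vec.scale_zero_left, THEN conjunct1, THEN spec]
    this[unfolded add_0 add_0_right mult_1 vec.scale_zero_left, THEN conjunct2, THEN spec]
  have g2: "dotp \<phi> (D *v x) *s ?w + (e * dotp \<phi> (D *v x)) *s u
      = dotp \<phi> x *s ?ww + (e * dotp \<phi> x) *s ?w + D *v x" for x
    using g(2)[of x] unfolding g(1) matrix_vector_right_distrib vector_scalar_commute .
  have h2: "dotp \<phi> (D *v x) *s ?w + (dotp \<phi> (D *v (D *v x)) + k * dotp \<phi> (D *v x)) *s u
     = dotp \<phi> x *s ?ww + (dotp \<phi> (D *v x) + k * dotp \<phi> x) *s ?w" for x
    using h(2)[of x] unfolding h(1) matrix_vector_right_distrib vector_scalar_commute .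
  have "e *s u = 0" using g2[of u] by (simp add: \<phi>)
  moreover have "u \<noteq> 0" using \<phi>(2) by auto
  ultimately have e: "e = 0" by simp
  define r where "r = dotp \<phi> (D *v ?ww) + k * dotp \<phi> ?ww"
  \<comment> \<open>the relation for \<open>h\<close> at \<open>D u\<close>\<close>
  have h3: "?ww + k *s ?w = r *s u"
  proof -
    have "dotp \<phi> ?ww *s ?w + r *s u = dotp \<phi> ?ww *s ?w + (?ww + k *s ?w)"
      using h2[of ?w]
      unfolding \<phi> r_def[symmetric] mult_1_right vec.scale_one vec.scale_left_distrib[of _ k]
      by (rule trans[OF _ add.left_commute])
    then show ?thesis by (simp only: add_left_cancel)
  qed
  have "dotp \<phi> ?ww + k = 0"
    using arg_cong[OF h3, of "dotp \<phi>"] by (simp add: \<phi>)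
  then have k: "dotp \<phi> ?ww = - k" by (rule eq_neg_iff_add_eq_0[THEN iffD2])
  \<comment> \<open>the relation for \<open>g\<close> at \<open>D u\<close>\<close>
  have two: "?ww + ?ww = (- k) *s ?w"
    using g2[of ?w] unfolding \<phi> e k mult_zero_left vec.scale_zero_left vec.scale_one add_0_right
    by (rule sym)
  from arg_cong[OF this, of "dotp \<phi>"] have "k = 0"
    unfolding dotp_simps \<phi> k by (simp only: mult_1_right add_cancel_left_right neg_equal_0_iff_equal)
  have ww2: "?ww + ?ww = 0"
    using two unfolding \<open>k = 0\<close> minus_zero vec.scale_zero_left .
  have "2 *s ?ww = ?ww + ?ww"
    by (simp only: Finite_Cartesian_Product.vec_eq_iff vector_smult_component vector_add_component mult_2
        simp_thms)
  then have "2 *s ?ww = 0" unfolding ww2 .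
  then have ww: "?ww = 0" by simp
  have "D *v x = outer ?w (\<phi> v* D) *v x" for x
  proof -
    have "dotp \<phi> (D *v x) *s ?w = D *v x"
      using g2[of x]
      unfolding e ww mult_zero_left vec.scale_zero_left vec.scale_zero_right add_0_right add_0 .
    then show ?thesis by (simp only: outer_mult_vec dotp_transfer)
  qed
  then have "D = outer ?w (\<phi> v* D)" unfolding matrix_eq by (rule allI)
  moreover have "dotp (\<phi> v* D) ?w = 0" by (simp add: dotp_transfer ww)
  ultimately show "rank_one_nilpotent D" unfolding rank_one_nilpotent_def by blast
qed

text \<open>For \<open>D = w r\<close> with \<open>w = D u\<close> and \<open>r = \<phi> D\<close>, the matrices \<open>w \<phi>\<close> and \<open>w \<phi> + u r\<close> lie in the
intersection and have independent coordinates. An arbitrary matrix \<open>\<Gamma>\<close> becomes an element \<open>\<Gamma>'\<close> of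
\<open>sym_params D\<close> with \<open>\<Gamma>' w = 0\<close> and \<open>r \<Gamma>' = 0\<close> after subtraction of \<open>p \<phi> + u \<psi>\<close> for
\<open>p = \<Gamma> w\<close> and \<open>\<psi> = r \<Gamma> - (r \<Gamma> w) \<phi>\<close>, so the sum is the whole space.\<close>
theorem dim_sym_params_rank_one_nilpotent:
  fixes D :: "complex^'n^'n::finite"
  assumes D: "D \<notin> scalar_matrices" and nil: "rank_one_nilpotent D"
  shows "vec.dim (sym_params D) = CARD('n)^2 + 4"
proof -
  obtain u \<phi> where \<phi>: "dotp \<phi> u = 0" "dotp \<phi> (D *v u) = 1"
    using nonscalar_witness[OF D] .
  obtain p q where pq: "D = outer p q" "dotp q p = 0" using nil unfolding rank_one_nilpotent_def by blast
  define w where "w = D *v u"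
  define r where "r = \<phi> v* D"
  have pu: "dotp q u * dotp \<phi> p = 1" using \<phi>(2) by (simp add: pq(1))
  have Dx: "D *v x = dotp r x *s w" for x
  proof -
    have "dotp r x *s w = (dotp q u * dotp \<phi> p) *s (dotp q x *s p)"
      by (simp add: r_def w_def dotp_transfer pq(1) mult_ac)
    then show ?thesis unfolding pu by (simp add: pq(1))
  qed
  have ru: "dotp r u = 1" and \<phi>w: "dotp \<phi> w = 1" and rw: "dotp r w = 0"
    using \<phi> by (simp_all add: r_def dotp_transfer w_def) (simp add: pq)
  let ?K = "sym_params D \<inter> probe u \<phi>"
  let ?P = "probe_coords D u \<phi> ` ?K"
  have K: "of_mat_part (outer p \<phi>) + of_mat_part (outer u \<psi>) \<in> probe u \<phi>" for p \<psi>
    unfolding probe_def by blast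
  have "?P = UNIV"
  proof -
    have sub: "vec.subspace ?P"
      by (intro vec.linear_subspace_image linear_probe_coords vec.subspace_inter subspace_sym_params
          subspace_probe)
    let ?g = "of_mat_part (outer w \<phi>) + of_mat_part (outer u 0)"
    let ?h = "of_mat_part (outer w \<phi>) + of_mat_part (outer u r)"
    have "?g \<in> ?K" "?h \<in> ?K"
      using K by (auto simp: sym_params_def Dx \<phi> \<phi>w rw ru vector_scalar_commute matrix_vector_right_distrib
          intro!: exI[of _ 1])
    then have "y $ False *s probe_coords D u \<phi> ?h + (y $ True - y $ False) *s probe_coords D u \<phi> ?g \<in> ?P"
        for y
      by (intro vec.subspace_add[OF sub] vec.subspace_scale[OF sub] imageI)
    moreover have "y = y $ False *s probe_coords D u \<phi> ?h + (y $ True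
        - y $ False) *s probe_coords D u \<phi> ?g" for y
      by (auto simp: probe_coords_def Finite_Cartesian_Product.vec_eq_iff Dx \<phi> \<phi>w rw ru
          matrix_vector_right_distrib)
    ultimately show ?thesis by (metis UNIV_eq_I)
  qed
  then have dK: "vec.dim ?K = 2"
    using dim_probe_Int_sym_params[OF \<phi>] by (simp add: vec.dim_UNIV card_cart_basis)
  have "g \<in> {x + y | x y. x \<in> sym_params D \<and> y \<in> probe u \<phi>}" for g
  proof -
    let ?G = "mat_part g"
    define \<psi> where "\<psi> = r v* ?G - dotp r (?G *v w) *s \<phi>"
    let ?y = "of_mat_part (outer (?G *v w) \<phi>) + of_mat_part (outer u \<psi>)"
    have "g - ?y \<in> sym_params D"
      unfolding sym_params_def
      by (auto intro!: exI[of _ 0] simp: Dx \<psi>_def dotp_transfer \<phi>w rw ru vector_scalar_commute)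
    moreover have "g = (g - ?y) + ?y" by simp
    ultimately show ?thesis using K by blast
  qed
  then have "{x + y | x y. x \<in> sym_params D \<and> y \<in> probe u \<phi>} = UNIV" by blast
  with dim_sym_params_eq[OF \<phi>] dK show ?thesis
    by (simp add: vec.dim_UNIV card_cart_basis CARD_params del: card_sum)
qed

section \<open>Similarity to the extremal Jordan matrix\<close>

lemma to_mat_carrier [simp]: "to_mat (A :: complex^'n^'n::finite) \<in> carrier_mat CARD('n) CARD('n)"
  by (simp add: to_mat_def)

lemma sum_index_enum: "(\<Sum>k<CARD('n). f (index_enum k :: 'n::finite)) = (\<Sum>i\<in>UNIV. f i)"
  by (rule sum.reindex_bij_betw[OF bij_betw_index_enum])

lemma index_enum_eq_iff: "i < CARD('n) \<Longrightarrow> j < CARD('n) \<Longrightarrow> (index_enum i :: 'n::finite) = index_enum j \<longleftrightarrow> i = j"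
  using bij_betw_index_enum[where ?'n='n] by (auto simp: bij_betw_def inj_on_def)

lemma index_enum_surj: obtains k where "k < CARD('n)" "(i :: 'n::finite) = index_enum k"
proof -
  have "i \<in> index_enum ` {..<CARD('n)}"
    using bij_betw_index_enum[where ?'n='n] by (simp add: bij_betw_def)
  then show thesis using that by auto
qed

lemma to_mat_mult: "to_mat (A ** B) = to_mat A * to_mat (B :: complex^'n^'n::finite)"
proof (rule eq_matI)
  fix i j assume "i < dim_row (to_mat A * to_mat B)" "j < dim_col (to_mat A * to_mat B)"
  then have ij: "i < CARD('n)" "j < CARD('n)" by (simp_all add: to_mat_def)
  have "(to_mat A * to_mat B) $$ (i, j) = (\<Sum>k<CARD('n). A $ index_enum i $ index_enum k * B $ index_enum
      k $ index_enum j)"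
    using ij by (simp add: to_mat_def scalar_prod_def atLeast0LessThan)
  also have "\<dots> = (A ** B) $ index_enum i $ index_enum j"
    by (simp add: matrix_matrix_mult_def sum_index_enum[of "\<lambda>k. A $ index_enum i $ k * B $ k $ index_enum j"])
  finally show "to_mat (A ** B) $$ (i, j) = (to_mat A * to_mat B) $$ (i, j)"
    using ij by (simp add: to_mat_def)
qed (simp_all add: to_mat_def)

lemma to_mat_one: "to_mat (Finite_Cartesian_Product.mat 1 :: complex^'n^'n::finite) = 1\<^sub>m CARD('n)"
  by (rule eq_matI) (simp_all add: to_mat_def Finite_Cartesian_Product.mat_def index_enum_eq_iff)

lemma jordan_matrix_zeros: "jordan_matrix (replicate k (1, 0 :: complex)) = 0\<^sub>m k k"
proof (induction k)
  case 0
  then show ?case by (simp add: jordan_matrix_def)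
next
  case (Suc k)
  show ?case
    unfolding replicate_Suc jordan_matrix_Cons Suc by (rule eq_matI) (auto
        simp: four_block_mat_def sum_list_replicate)
qed

lemma extremal_jordan_matrix_eq:
  assumes "n \<ge> 2"
  shows "extremal_jordan_matrix n = Matrix.mat n n (\<lambda>(i, j). if i = 0 \<and> j = 1 then 1 else 0)"
  using assms unfolding extremal_jordan_matrix_def jordan_matrix_Cons jordan_matrix_zeros
  by (intro eq_matI) (auto simp: four_block_mat_def sum_list_replicate Let_def)

text \<open>The extremal matrix is the matrix unit \<open>e\<^sub>0 e\<^sub>1\<^sup>T\<close>, so \<open>P J Q\<close> is the product of column 0 of
\<open>P\<close> and row 1 of \<open>Q\<close>, and \<open>Q P = 1\<close> has the entry 0 at \<open>(1, 0)\<close>.\<close>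
lemma rank_one_nilpotent_if_similar:
  fixes D :: "complex^'n^'n::finite"
  assumes n: "CARD('n) \<ge> 2" and sim: "similar_mat (to_mat D) (extremal_jordan_matrix CARD('n))"
  shows "rank_one_nilpotent D"
proof -
  let ?n = "CARD('n)" let ?J = "extremal_jordan_matrix ?n"
  obtain P Q where PQ: "P \<in> carrier_mat ?n ?n" "Q \<in> carrier_mat ?n ?n" "Q * P = 1\<^sub>m ?n" "to_mat D
      = P * ?J * Q"
    using sim unfolding similar_mat_def similar_mat_wit_def Let_def by (auto simp: to_mat_def)
  have J: "?J \<in> carrier_mat ?n ?n" by (simp add: extremal_jordan_matrix_eq[OF n])
  have PJ: "(P * ?J) $$ (i, k) = (if k = 1 then P $$ (i, 0) else 0)" if "i < ?n" "k < ?n" for i k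
    using PQ(1) J that n by (simp add: extremal_jordan_matrix_eq scalar_prod_def if_distrib cong: if_cong)
  have entry: "to_mat D $$ (i, j) = P $$ (i, 0) * Q $$ (1, j)" if "i < ?n" "j < ?n" for i j
  proof -
    have "to_mat D $$ (i, j) = (\<Sum>k=0..<?n. (P * ?J) $$ (i, k) * Q $$ (k, j))"
      unfolding PQ(4) using PQ(1,2) J that by (subst index_mult_mat(1)) (simp_all add: scalar_prod_def)
    also have "\<dots> = (\<Sum>k=0..<?n. if k = 1 then P $$ (i, 0) * Q $$ (1, j) else 0)"
      using that by (intro sum.cong) (auto simp: PJ)
    finally show ?thesis using n by simp
  qed
  define pos :: "'n \<Rightarrow> nat" where "pos i = the_inv_into {..<?n} index_enum i" for i
  have pos: "pos (index_enum k) = k" if "k < ?n" for k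
    unfolding pos_def
    by (rule the_inv_into_f_f)
      (use bij_betw_index_enum[where ?'n='n] that in \<open>auto simp: bij_betw_def\<close>)
  define p :: "complex^'n" where "p = (\<chi> i. P $$ (pos i, 0))"
  define q :: "complex^'n" where "q = (\<chi> i. Q $$ (1, pos i))"
  have "D $ i $ j = p $ i * q $ j" for i j
  proof -
    obtain k where k: "k < ?n" "i = index_enum k" by (rule index_enum_surj)
    obtain l where l: "l < ?n" "j = index_enum l" by (rule index_enum_surj)
    show ?thesis using entry[OF k(1) l(1)] k l by (simp add: p_def q_def pos) (simp add: to_mat_def)
  qed
  then have "D = outer p q" by (simp add: outer_def Finite_Cartesian_Product.vec_eq_iff)
  moreover have "dotp q p = 0"
  proof -
    have "dotp q p = (\<Sum>k<?n. Q $$ (1, k) * P $$ (k, 0))"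
      unfolding dotp_def by (subst sum_index_enum[symmetric]) (simp add: p_def q_def pos)
    also have "\<dots> = (Q * P) $$ (1, 0)"
      using PQ(1,2) n by (simp add: scalar_prod_def atLeast0LessThan)
    also have "\<dots> = 0" using n by (simp add: PQ(3))
    finally show ?thesis .
  qed
  ultimately show ?thesis unfolding rank_one_nilpotent_def by blast
qed

text \<open>Put \<open>q\<close> into row \<open>i\<close> of the identity matrix. If the pivot of \<open>q\<close> is at another place \<open>k\<close>, row \<open>k\<close> must
in turn take over the row \<open>e\<^sub>i\<close> that was displaced.\<close>
lemma invertible_with_row:
  fixes q :: "complex^'n::finite"
  assumes "q \<noteq> 0"
  obtains C where "invertible C" "C $ i = q" "\<And>l. l \<noteq> i \<Longrightarrow> q $ l = 0 \<Longrightarrow> C *v axis l 1 = axis l 1"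
proof -
  have "\<exists>k. q $ k \<noteq> 0"
    using assms by (auto simp: Finite_Cartesian_Product.vec_eq_iff)
  then obtain k where k: "q $ k \<noteq> 0" by blast
  define C :: "complex^'n^'n" where
    "C = (\<chi> j. if j = i then q else if j = k then axis i 1 else axis j 1)"
  have Cv: "(C *v x) $ j = (if j = i then dotp q x else if j = k then x $ i else x $ j)" for x j
  proof -
    have "(C *v x) $ j = dotp (C $ j) x"
      by (simp add: matrix_vector_mult_def dotp_def)
    then show ?thesis by (simp add: C_def)
  qed
  have "x = 0" if "C *v x = 0" for x
  proof -
    have Cx: "(C *v x) $ j = 0" for j using that by simp
    have off: "x $ j = 0" if "j \<noteq> k" for j
      using Cx[of j] Cx[of k] that unfolding Cv by (auto split: if_splits)
    have "dotp q x = q $ k * x $ k"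
      unfolding dotp_def by (subst sum.remove[of _ k]) (auto simp: off)
    then have "x $ k = 0" using Cx[of i] k unfolding Cv by simp
    with off have "x $ j = 0" for j by (cases "j = k") simp_all
    then show "x = 0" by (simp add: Finite_Cartesian_Product.vec_eq_iff)
  qed
  then have "invertible C"
    by (simp add: invertible_left_inverse matrix_left_invertible_ker)
  moreover have "C $ i = q" by (simp add: C_def)
  moreover have "C *v axis l 1 = axis l 1" if "l \<noteq> i" "q $ l = 0" for l
  proof -
    have "l \<noteq> k" using k that by auto
    then show ?thesis using that
      by (simp add: Finite_Cartesian_Product.vec_eq_iff Cv) (auto simp: axis_def)
  qed
  ultimately show thesis by (rule that)
qed

text \<open>For \<open>D = p q\<close> one needs an invertible \<open>P\<close> with \<open>P e\<^sub>0 = p\<close> and \<open>q P = e\<^sub>1\<^sup>T\<close>. First \<open>A\<close> is chosen with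
\<open>A e\<^sub>0 = p\<close>; then \<open>r = q A\<close> satisfies \<open>r e\<^sub>0 = q p = 0\<close>, so there is an invertible \<open>C\<close> with row \<open>r\<close> in
position 1 that fixes \<open>e\<^sub>0\<close>, and \<open>P = A C\<^sup>-\<^sup>1\<close> is as required.\<close>
lemma similar_if_rank_one_nilpotent:
  fixes D :: "complex^'n^'n::finite"
  assumes n: "CARD('n) \<ge> 2" and nz: "D \<noteq> 0" and nil: "rank_one_nilpotent D"
  shows "similar_mat (to_mat D) (extremal_jordan_matrix CARD('n))"
proof -
  obtain p q where D: "D = outer p q" and qp: "dotp q p = 0" using nil
      unfolding rank_one_nilpotent_def by blast
  have p0: "p \<noteq> 0" and q0: "q \<noteq> 0" using nz by (auto simp: D outer_def Finite_Cartesian_Product.vec_eq_iff)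
  let ?i = "index_enum 0 :: 'n" and ?j = "index_enum 1 :: 'n"
  have ij: "?i \<noteq> ?j" using n by (simp add: index_enum_eq_iff)
  obtain A' where A': "invertible A'" "A' $ ?i = p" using invertible_with_row[OF p0, of ?i] by metis
  define A where "A = transpose A'"
  have A: "invertible A" "A *v axis ?i 1 = p"
  proof -
    show "invertible A" unfolding A_def using A'(1) by (simp add: invertible_det_nz det_transpose)
    show "A *v axis ?i 1 = p"
      using A'(2) by (simp add: A_def transpose_def matrix_vector_mult_def axis_def
          Finite_Cartesian_Product.vec_eq_iff if_distrib cong: if_cong)
  qed
  define r where "r = q v* A"
  have r0: "r \<noteq> 0"
  proof
    assume r: "r = 0"
    have "dotp q x = 0" for x
    proof -
      obtain B where "A ** B = Finite_Cartesian_Product.mat 1" using A(1) unfolding invertible_def by blast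
      then have "A *v (B *v x) = x" by (simp add: matrix_vector_mul_assoc)
      then show ?thesis using dotp_transfer[of q A "B *v x"] r by (simp add: r_def)
    qed
    from this[of "axis _ 1"] have "q = 0" by (simp add: Finite_Cartesian_Product.vec_eq_iff)
    with q0 show False ..
  qed
  have "r $ ?i = dotp r (axis ?i 1)" by simp
  also have "\<dots> = 0" unfolding r_def dotp_transfer A(2) by (rule qp)
  finally have ri: "r $ ?i = 0" .
  obtain C where C: "invertible C" "C $ ?j = r" "C *v axis ?i 1 = axis ?i 1"
    using invertible_with_row[OF r0, of ?j] ij ri by metis
  obtain C' where C': "C ** C' = Finite_Cartesian_Product.mat 1" "C' ** C = Finite_Cartesian_Product.mat 1"
    using C(1) unfolding invertible_def by blast
  define P where "P = A ** C'"
  have "invertible P" unfolding P_def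
    using A(1) C' by (intro invertible_mult) (auto simp: invertible_def)
  then obtain P' where P': "P ** P' = Finite_Cartesian_Product.mat 1" "P' ** P
      = Finite_Cartesian_Product.mat 1"
    unfolding invertible_def by blast
  define J where "J = outer (axis ?i 1) (axis ?j (1 :: complex))"
  have "C' *v axis ?i 1 = axis ?i 1"
    using arg_cong[OF C(3), of "(*v) C'"] by (simp add: matrix_vector_mul_assoc C'(2))
  then have Pi: "P *v axis ?i 1 = p" by (simp add: P_def A(2) flip: matrix_vector_mul_assoc)
  have "dotp q (P *v x) = x $ ?j" for x
  proof -
    have "dotp q (P *v x) = dotp r (C' *v x)"
      by (simp add: P_def r_def dotp_transfer flip: matrix_vector_mul_assoc)
    also have "\<dots> = (C *v (C' *v x)) $ ?j"
      by (simp add: matrix_vector_mult_def[of C] dotp_def flip: C(2))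
    also have "\<dots> = x $ ?j" by (simp add: matrix_vector_mul_assoc C'(1))
    finally show ?thesis .
  qed
  then have "(D ** P) *v x = (P ** J) *v x" for x
    by (simp add: D J_def Pi vector_scalar_commute flip: matrix_vector_mul_assoc)
  then have "D ** P = P ** J" unfolding matrix_eq by (rule allI)
  then have "D = P ** J ** P'" by (metis P'(1) matrix_mul_assoc matrix_mul_rid)
  then have eq: "to_mat D = to_mat P * to_mat J * to_mat P'" by (simp add: to_mat_mult)
  have "to_mat J = extremal_jordan_matrix CARD('n)"
    unfolding extremal_jordan_matrix_eq[OF n]
    using n by (intro eq_matI) (auto simp: to_mat_def J_def outer_def axis_def index_enum_eq_iff)
  moreover have "to_mat P * to_mat P' = 1\<^sub>m CARD('n)" "to_mat P' * to_mat P = 1\<^sub>m CARD('n)"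
    by (simp_all add: P' to_mat_one flip: to_mat_mult)
  ultimately have "similar_mat_wit (to_mat D) (extremal_jordan_matrix CARD('n)) (to_mat P) (to_mat P')"
    using eq to_mat_carrier[of J]
    by (intro similar_mat_witI[OF _ _ _ to_mat_carrier _ to_mat_carrier to_mat_carrier]) (simp_all only:)
  then show ?thesis unfolding similar_mat_def by (intro exI)
qed

section \<open>The symmetry algebra in coordinates\<close>

text \<open>The solution is entire, and the equation makes all its Taylor coefficients at 0 vanish.\<close>

lemma linear_ode_unique:
  fixes D :: "complex^'n^'n::finite"
  assumes x: "\<And>t b. ((\<lambda>t. x t $ b) has_field_derivative x' t $ b) (at t)"
    and x': "\<And>t b. ((\<lambda>t. x' t $ b) has_field_derivative (D *v x t) $ b) (at t)"
    and 0: "x 0 = 0" "x' 0 = 0"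
  shows "x t = 0"
proof -
  have hol: "(\<lambda>t. x t $ b) holomorphic_on UNIV" for b
    using x by (auto simp: holomorphic_on_open)
  have d1: "deriv (\<lambda>t. x t $ b) = (\<lambda>t. x' t $ b)" "deriv (\<lambda>t. x' t $ b) = (\<lambda>t. (D *v x t) $ b)" for b
    by (auto intro!: ext DERIV_imp_deriv x x')
  have hd: "(deriv ^^ k) (\<lambda>t. x t $ b) holomorphic_on UNIV" for k b
    by (intro holomorphic_higher_deriv hol open_UNIV)
  have rec: "(deriv ^^ (k + 2)) (\<lambda>t. x t $ b) = (\<lambda>t. \<Sum>a\<in>UNIV. D $ b $ a * (deriv ^^ k) (\<lambda>t. x t $ a) t)"
      for k b
  proof (induction k)
    case 0
    show ?case by (simp add: numeral_2_eq_2 d1) (simp add: matrix_vector_mult_def)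
  next
    case (Suc k)
    have "((deriv ^^ k) (\<lambda>t. x t $ a) has_field_derivative (deriv ^^ Suc k) (\<lambda>t. x t $ a) t) (at t)" for a t
      using holomorphic_derivI[OF hd open_UNIV] by simp
    then have "((\<lambda>t. \<Sum>a\<in>UNIV. D $ b $ a * (deriv ^^ k) (\<lambda>t. x t $ a) t) has_field_derivative
        (\<Sum>a\<in>UNIV. D $ b $ a * (deriv ^^ Suc k) (\<lambda>t. x t $ a) t)) (at t)" for t
      by (intro DERIV_sum DERIV_cmult)
    then have "deriv (\<lambda>t. \<Sum>a\<in>UNIV. D $ b $ a * (deriv ^^ k) (\<lambda>t. x t $ a) t) =
      (\<lambda>t. \<Sum>a\<in>UNIV. D $ b $ a * (deriv ^^ Suc k) (\<lambda>t. x t $ a) t)"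
      by (intro ext DERIV_imp_deriv)
    with Suc show ?case by simp
  qed
  have "(deriv ^^ k) (\<lambda>t. x t $ b) 0 = 0" for k b
  proof (induction k arbitrary: b rule: less_induct)
    case (less k)
    consider "k = 0" | "k = 1" | m where "k = m + 2"
      by (metis One_nat_def add_2_eq_Suc' not0_implies_Suc)
    then show ?case
    proof cases
      case 3
      then show ?thesis using less by (simp only: rec) simp
    qed (simp_all add: 0 d1)
  qed
  then have "x t $ b = 0" for b
    by (intro holomorphic_fun_eq_0_on_connected[OF hol open_UNIV connected_UNIV, where z = 0]) auto
  then show ?thesis by (simp add: Finite_Cartesian_Product.vec_eq_iff)
qed

text \<open>The coordinates of a symmetry field, defined for arbitrary fields by evaluation and differentiation at
the origin.\<close>
definition params_of :: "('n::finite) vfield \<Rightarrow> 'n params" where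
  "params_of Q = (\<chi> k. case k of
     Inl (i, j) \<Rightarrow> snd (Q (0, axis j 1)) $ i - snd (Q (0, 0)) $ i
   | Inr (Inl (Inl i)) \<Rightarrow> snd (Q (0, 0)) $ i
   | Inr (Inl (Inr i)) \<Rightarrow> deriv (\<lambda>t. snd (Q (t, 0)) $ i) 0
   | Inr (Inr _) \<Rightarrow> fst (Q (0, 0)))"

definition affine_field :: "complex \<Rightarrow> complex \<Rightarrow> complex^'n^'n \<Rightarrow> (complex \<Rightarrow> complex^'n) \<Rightarrow> ('n::finite)
    vfield" where
  "affine_field \<alpha> c G x = (\<lambda>z. (\<alpha> + c * fst z, x (fst z) + G *v snd z))"

definition affine_symmetry ::
  "complex^'n^'n \<Rightarrow> complex \<Rightarrow> complex^'n^'n \<Rightarrow> (complex \<Rightarrow> complex^'n) \<Rightarrow>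
     (complex \<Rightarrow> complex^('n::finite)) \<Rightarrow> bool" where
  "affine_symmetry D c G x x' \<longleftrightarrow>
     (\<forall>v. G *v (D *v v) = D *v (G *v v) + (2 * c) *s (D *v v)) \<and>
     (\<forall>t b. ((\<lambda>t. x t $ b) has_field_derivative x' t $ b) (at t)) \<and>
     (\<forall>t b. ((\<lambda>t. x' t $ b) has_field_derivative (D *v x t) $ b) (at t))"

lemma max_lie_algebra_linear_system:
  fixes D :: "complex^'n^'n::finite"
  assumes "D \<notin> scalar_matrices"
  shows "max_lie_algebra (linear_system D) = {affine_field \<alpha> c G x | \<alpha> c G x x'. affine_symmetry D c G x x'}"
proof (intro equalityI subsetI)
  fix Q assume "Q \<in> max_lie_algebra (linear_system D)"
  then have "lie_symmetry (linear_system D) Q" by (simp add: max_lie_algebra_def)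
  then obtain \<alpha> c G x x' where Q: "Q = (\<lambda>z. (\<alpha> + c * fst z, x (fst z) + G *v snd z))"
    and "\<And>v. G *v (D *v v) = D *v (G *v v) + (2 * c) *s (D *v v)"
    "\<And>t b. ((\<lambda>t. x t $ b) has_field_derivative x' t $ b) (at t)"
    "\<And>t b. ((\<lambda>t. x' t $ b) has_field_derivative (D *v x t) $ b) (at t)"
    using assms by (rule linear_system_symmetry_form) (rule that)
  then have "affine_symmetry D c G x x'"
    unfolding affine_symmetry_def by (intro conjI allI)
  moreover have "Q = affine_field \<alpha> c G x"
    unfolding affine_field_def by (rule Q)
  ultimately show "Q \<in> {affine_field \<alpha> c G x | \<alpha> c G x x'. affine_symmetry D c G x x'}"
    by blast
next
  fix Q assume "Q \<in> {affine_field \<alpha> c G x | \<alpha> c G x x'. affine_symmetry D c G x x'}"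
  then obtain \<alpha> c G x x' where Q: "Q = affine_field \<alpha> c G x" and sym: "affine_symmetry D c G x x'"
    by blast
  show "Q \<in> max_lie_algebra (linear_system D)"
    unfolding max_lie_algebra_def mem_Collect_eq Q affine_field_def
    by (rule linear_system_symmetryI[of G D c x x']) (use sym in \<open>simp_all only: affine_symmetry_def\<close>)
qed

lemma max_lie_algebra_linear_systemE:
  fixes D :: "complex^'n^'n::finite"
  assumes "D \<notin> scalar_matrices" "Q \<in> max_lie_algebra (linear_system D)"
  obtains \<alpha> c G x x' where "Q = affine_field \<alpha> c G x" "affine_symmetry D c G x x'"
  using assms(2) unfolding max_lie_algebra_linear_system[OF assms(1)] by blast

definition mk_params :: "complex^'n^'n \<Rightarrow> complex^'n \<Rightarrow> complex^'n \<Rightarrow> complex \<Rightarrow> ('n::finite) params" where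
  "mk_params G a b \<alpha> = (\<chi> k. case k of
     Inl (i, j) \<Rightarrow> G $ i $ j | Inr (Inl (Inl i)) \<Rightarrow> a $ i | Inr (Inl (Inr i)) \<Rightarrow> b $ i | Inr (Inr _) \<Rightarrow> \<alpha>)"

lemma mat_part_mk_params [simp]: "mat_part (mk_params G a b \<alpha>) = G"
  by (simp add: mat_part_def mk_params_def Finite_Cartesian_Product.vec_eq_iff)

lemma params_of_affine_field:
  fixes D :: "complex^'n^'n::finite"
  assumes "affine_symmetry D c G x x'"
  shows "params_of (affine_field \<alpha> c G x) = mk_params G (x 0) (x' 0) \<alpha>"
proof -
  have d: "deriv (\<lambda>t. x t $ i) 0 = x' 0 $ i" for i
    using assms unfolding affine_symmetry_def by (intro DERIV_imp_deriv) blast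
  have col: "(G *v axis j 1) $ i = G $ i $ j" for i j
    by (simp add: matrix_vector_mult_def axis_def if_distrib cong: if_cong)
  show ?thesis
    by (auto simp: params_of_def mk_params_def affine_field_def d col Finite_Cartesian_Product.vec_eq_iff
        split: sum.split)
qed

lemma affine_symmetryD:
  fixes D :: "complex^'n^'n::finite"
  assumes "affine_symmetry D c G x x'"
  shows "G *v (D *v v) = D *v (G *v v) + (2 * c) *s (D *v v)"
    and "((\<lambda>t. x t $ b) has_field_derivative x' t $ b) (at t)"
    and "((\<lambda>t. x' t $ b) has_field_derivative (D *v x t) $ b) (at t)"
  using assms unfolding affine_symmetry_def by blast+

lemma affine_symmetry_add:
  fixes D :: "complex^'n^'n::finite"
  assumes s: "affine_symmetry D c G x x'" and r: "affine_symmetry D d H y y'"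
  shows "affine_symmetry D (c + d) (G + H) (\<lambda>t. x t + y t) (\<lambda>t. x' t + y' t)"
  unfolding affine_symmetry_def vector_add_component
    matrix_vector_mult_add_rdistrib matrix_vector_right_distrib distrib_left vec.scale_left_distrib
    affine_symmetryD(1)[OF s] affine_symmetryD(1)[OF r]
  by (intro conjI allI DERIV_add affine_symmetryD(2,3)[OF s] affine_symmetryD(2,3)[OF r]) (simp only: add_ac)

lemma mat_scalar_mult:
  fixes G :: "complex^'n^'n::finite"
  shows "(Finite_Cartesian_Product.mat k ** G) *v y = k *s (G *v y)"
proof -
  have "Finite_Cartesian_Product.mat k *v z = k *s z" for z :: "complex^'n"
    by (simp add: matrix_vector_mult_def Finite_Cartesian_Product.mat_def
        Finite_Cartesian_Product.vec_eq_iff if_distrib[where f="\<lambda>x. x * _"] cong: if_cong)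
  then show ?thesis by (simp flip: matrix_vector_mul_assoc)
qed

lemma affine_symmetry_scale:
  fixes D :: "complex^'n^'n::finite"
  assumes s: "affine_symmetry D c G x x'"
  shows "affine_symmetry D (k * c) (Finite_Cartesian_Product.mat k ** G) (\<lambda>t. k *s x t) (\<lambda>t. k *s x' t)"
  unfolding affine_symmetry_def vector_smult_component mat_scalar_mult vector_scalar_commute
    vec.scale_right_distrib vec.scale_scale affine_symmetryD(1)[OF s]
  by (intro conjI allI DERIV_cmult affine_symmetryD(2,3)[OF s]) (simp only: mult.left_commute)

lemma affine_field_add:
  fixes G H :: "complex^'n^'n::finite"
  shows "affine_field \<alpha> c G x + affine_field \<beta> d H y = affine_field (\<alpha> + \<beta>) (c + d) (G + H) (\<lambda>t. x t + y t)"
  unfolding affine_field_def plus_fun_def add_Pair matrix_vector_mult_add_rdistrib distrib_right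
  by (simp only: add_ac)

lemma affine_field_scale:
  fixes G :: "complex^'n^'n::finite"
  shows "vf_scale k (affine_field \<alpha> c G x) = affine_field (k * \<alpha>) (k * c) (Finite_Cartesian_Product.mat k
      ** G) (\<lambda>t. k *s x t)"
  unfolding affine_field_def vf_scale_def cscale_def mat_scalar_mult fst_conv snd_conv
      vec.scale_right_distrib distrib_left
  by (simp only: mult.assoc)

lemma mk_params_add: "mk_params (G + H) (a + a') (b + b') (\<alpha> + \<beta>) = mk_params G a b \<alpha> + mk_params H a' b' \<beta>"
  by (auto simp: mk_params_def Finite_Cartesian_Product.vec_eq_iff split: sum.split)

lemma mk_params_scale: "mk_params (Finite_Cartesian_Product.mat k ** G) (k *s a) (k *s b) (k * \<alpha>)
    = k *s mk_params G a b \<alpha>"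
  by (auto simp: mk_params_def matrix_matrix_mult_def Finite_Cartesian_Product.mat_def
      Finite_Cartesian_Product.vec_eq_iff if_distrib[where f="\<lambda>x. x * _"] split: sum.split cong: if_cong)

interpretation vf_vec: vector_space_pair "vf_scale :: complex \<Rightarrow> ('n::finite) vfield \<Rightarrow> 'n vfield"
  "(*s) :: complex \<Rightarrow> complex^'m::finite \<Rightarrow> complex^'m"
  by unfold_locales

text \<open>Linearity of \<open>f\<close> is confined to \<open>V\<close> because the derivative in \<open>params_of\<close> is not additive on fields
that are not differentiable. A linear map \<open>g\<close> on all fields that agrees with \<open>f\<close> on a basis of \<open>V\<close> does
    the work.\<close>
lemma vf_dim_eq_by_coordinates:
  fixes f :: "('n::finite) vfield \<Rightarrow> complex^'m::finite"
  assumes V: "vf.subspace V"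
    and add: "\<And>Q R. Q \<in> V \<Longrightarrow> R \<in> V \<Longrightarrow> f (Q + R) = f Q + f R"
    and scale: "\<And>k Q. Q \<in> V \<Longrightarrow> f (vf_scale k Q) = k *s f Q"
    and inj: "\<And>Q. Q \<in> V \<Longrightarrow> f Q = 0 \<Longrightarrow> Q = 0"
  shows "vf_finite_dimensional V" "vf.dim V = vec.dim (f ` V)"
proof -
  obtain B where B: "B \<subseteq> V" "vf.independent B" "V \<subseteq> vf.span B" "card B = vf.dim V"
    using vf.basis_exists by blast
  have span: "vf.span B = V" using B(1,3) V by (simp add: vf.span_minimal subset_antisym)
  obtain g where g: "Vector_Spaces.linear vf_scale (*s) g" "\<And>b. b \<in> B \<Longrightarrow> g b = f b"
    using vf_vec.linear_independent_extend[OF B(2), of f] by blast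
  interpret g: Vector_Spaces.linear vf_scale "(*s)" g by (rule g(1))
  have f0: "f 0 = 0" using scale[of 0 0] vf.subspace_0[OF V] by simp
  have gf: "g Q = f Q" if "Q \<in> V" for Q
  proof -
    have "Q \<in> vf.span B" using that span by simp
    then have "Q \<in> V \<and> g Q = f Q"
    proof (induction rule: vf.span_induct_alt)
      case base
      show ?case using vf.subspace_0[OF V] g.zero f0 by (intro conjI) (simp_all only:)
    next
      case (step c b Q)
      show ?case
      proof
        have b: "b \<in> V" "g b = f b" and Q: "Q \<in> V" "g Q = f Q" using step B(1) g(2) by auto
        have cb: "vf_scale c b \<in> V" by (rule vf.subspace_scale[OF V b(1)])
        show "vf_scale c b + Q \<in> V" by (rule vf.subspace_add[OF V cb Q(1)])
        show "g (vf_scale c b + Q) = f (vf_scale c b + Q)"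
          unfolding g.add g.scale add[OF cb Q(1)] scale[OF b(1)] b(2) Q(2) ..
      qed
    qed
    then show ?thesis by simp
  qed
  have "inj_on g (vf.span B)"
    unfolding span using g(1) V vf_vec.linear_inj_on_iff_eq_0[of g V] gf inj by auto
  then have ind: "vec.independent (g ` B)" and injB: "inj_on g B"
    using vf_vec.linear_independent_injective_image[OF g(1) B(2)] inj_on_subset vf.span_superset by blast+
  have "finite (g ` B)" using vec.independent_bound_general[OF ind] by blast
  then have fin: "finite B" using finite_imageD injB by blast
  then show "vf_finite_dimensional V"
    unfolding vf_finite_dimensional_def using B(3) by blast
  have "f ` V = vec.span (g ` B)"
    using g.span_image[of B] gf unfolding span by (simp cong: image_cong)
  then show "vf.dim V = vec.dim (f ` V)"
    using vec.dim_eq_card_independent[OF ind] card_image[OF injB] B(4) by simp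
qed

lemma rank_one_nilpotent_square: "rank_one_nilpotent D \<Longrightarrow> D *v (D *v v) = 0"
  unfolding rank_one_nilpotent_def by (auto simp: vector_scalar_commute)

text \<open>A symmetry with vanishing coordinates is zero by uniqueness for \<open>\<chi>'' = D \<chi>\<close>, and because \<open>c D = 0\<close>
with \<open>D \<noteq> 0\<close>. Surjectivity onto \<open>sym_params D\<close> needs the existence of solutions, which for \<open>D\<^sup>2 = 0\<close>
are polynomials.\<close>
lemma dim_max_lie_algebra:
  fixes D :: "complex^'n^'n::finite"
  assumes D: "D \<notin> scalar_matrices"
  defines "V \<equiv> max_lie_algebra (linear_system D)"
  shows "vf_finite_dimensional V" "vf.dim V = vec.dim (params_of ` V)" "params_of ` V \<subseteq> sym_params D"
    and "rank_one_nilpotent D \<Longrightarrow> params_of ` V = sym_params D"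
proof -
  have E: thesis if QV: "Q \<in> V" and cont:
    "\<And>\<alpha> c G x x'. Q = affine_field \<alpha> c G x \<Longrightarrow> affine_symmetry D c G x x'
        \<Longrightarrow> params_of Q = mk_params G (x 0) (x' 0) \<alpha> \<Longrightarrow> thesis"
    for Q thesis
  proof -
    obtain \<alpha> c G x x' where Q: "Q = affine_field \<alpha> c G x" "affine_symmetry D c G x x'"
      by (rule max_lie_algebra_linear_systemE[OF D QV[unfolded V_def]])
    show thesis
      by (rule cont[OF Q]) (simp only: Q(1) params_of_affine_field[OF Q(2)])
  qed
  have I: "affine_field \<alpha> c G x \<in> V" if "affine_symmetry D c G x x'" for \<alpha> c G x x'
    unfolding V_def max_lie_algebra_linear_system[OF D] using that by blast
  have add: "Q + R \<in> V \<and> params_of (Q + R) = params_of Q + params_of R" if "Q \<in> V" "R \<in> V" for Q R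
    using that(1)
  proof (rule E)
    fix \<alpha> c G x x' assume Q: "Q = affine_field \<alpha> c G x" "affine_symmetry D c G x x'"
      "params_of Q = mk_params G (x 0) (x' 0) \<alpha>"
    show ?thesis
      using that(2)
    proof (rule E)
      fix \<beta> d H y y' assume R: "R = affine_field \<beta> d H y" "affine_symmetry D d H y y'"
      "params_of R = mk_params H (y 0) (y' 0) \<beta>"
      note s = affine_symmetry_add[OF Q(2) R(2)]
      show ?thesis
        using I[OF s, of "\<alpha> + \<beta>"] params_of_affine_field[OF s, of "\<alpha> + \<beta>"]
        unfolding Q(3) R(3) unfolding Q(1) R(1) affine_field_add mk_params_add by simp
    qed
  qed
  have scale: "vf_scale k Q \<in> V \<and> params_of (vf_scale k Q) = k *s params_of Q" if "Q \<in> V" for k Q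
    using that
  proof (rule E)
    fix \<alpha> c G x x' assume Q: "Q = affine_field \<alpha> c G x" "affine_symmetry D c G x x'"
      "params_of Q = mk_params G (x 0) (x' 0) \<alpha>"
    note s = affine_symmetry_scale[OF Q(2), of k]
    show ?thesis
      using I[OF s, of "k * \<alpha>"] params_of_affine_field[OF s, of "k * \<alpha>"]
      unfolding Q(3) unfolding Q(1) affine_field_scale mk_params_scale by simp
  qed
  have "affine_symmetry D 0 0 (\<lambda>t. 0) (\<lambda>t. 0)"
    by (simp add: affine_symmetry_def)
  from I[OF this] have zero: "0 \<in> V"
    by (simp add: affine_field_def zero_fun_def zero_prod_def)
  have V: "vf.subspace V"
    unfolding vf.subspace_def
    by (intro conjI ballI allI zero add[THEN conjunct1] scale[THEN conjunct1])
  have inj: "Q = 0" if "Q \<in> V" and 0: "params_of Q = 0" for Q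
    using that(1)
  proof (rule E)
    fix \<alpha> c G x x' assume Q: "Q = affine_field \<alpha> c G x" "affine_symmetry D c G x x'"
      "params_of Q = mk_params G (x 0) (x' 0) \<alpha>"
    have z: "mk_params G (x 0) (x' 0) \<alpha> $ k = 0" for k using Q(3) 0 by simp
    have "G $ i $ j = 0" for i j using z[of "Inl (i, j)"] by (simp add: mk_params_def)
    then have G: "G = 0" by (simp add: Finite_Cartesian_Product.vec_eq_iff)
    have "x 0 $ i = 0" for i using z[of "Inr (Inl (Inl i))"] by (simp add: mk_params_def)
    then have x0: "x 0 = 0" by (simp add: Finite_Cartesian_Product.vec_eq_iff)
    have "x' 0 $ i = 0" for i using z[of "Inr (Inl (Inr i))"] by (simp add: mk_params_def)
    then have x'0: "x' 0 = 0" by (simp add: Finite_Cartesian_Product.vec_eq_iff)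
    have \<alpha>: "\<alpha> = 0" using z[of "Inr (Inr ())"] by (simp add: mk_params_def)
    have x: "x t = 0" for t
      using affine_symmetryD(2,3)[OF Q(2)] x0 x'0 by (rule linear_ode_unique)
    obtain u \<phi> where "dotp \<phi> u = 0" "dotp \<phi> (D *v u) = 1" using nonscalar_witness[OF D] .
    then have "D *v u \<noteq> 0" by (metis dotp_simps(7) zero_neq_one)
    moreover have "(2 * c) *s (D *v u) = 0"
      using affine_symmetryD(1)[OF Q(2), of u] unfolding G by simp
    ultimately have "c = 0" by simp
    then show "Q = 0" by (simp add: Q(1) affine_field_def \<alpha> x G zero_fun_def zero_prod_def)
  qed
  note dim = vf_dim_eq_by_coordinates[OF V add[THEN conjunct2] scale[THEN conjunct2] inj]
  show "vf_finite_dimensional V" by (rule dim(1))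
  show "vf.dim V = vec.dim (params_of ` V)" by (rule dim(2))
  show sub: "params_of ` V \<subseteq> sym_params D"
  proof safe
    fix Q assume "Q \<in> V"
    then show "params_of Q \<in> sym_params D"
    proof (rule E)
      fix \<alpha> c G x x'
      assume p: "affine_symmetry D c G x x'"
      "params_of Q = mk_params G (x 0) (x' 0) \<alpha>"
      show ?thesis
        unfolding sym_params_def mem_Collect_eq p(2) mat_part_mk_params
        by (rule exI[of _ "2 * c"]) (rule allI, rule affine_symmetryD(1)[OF p(1)])
    qed
  qed
  assume nil: "rank_one_nilpotent D"
  show "params_of ` V = sym_params D"
  proof (intro equalityI sub subsetI)
    fix g assume "g \<in> sym_params D"
    then obtain c where c: "\<And>v. mat_part g *v (D *v v) = D *v (mat_part g *v v) + c *s (D *v v)"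
      unfolding sym_params_def by blast
    define a :: "complex^'n" where "a = (\<chi> i. g $ Inr (Inl (Inl i)))"
    define b :: "complex^'n" where "b = (\<chi> i. g $ Inr (Inl (Inr i)))"
    \<comment> \<open>the Taylor expansion of the solution, which stops because \<open>D\<^sup>2 = 0\<close>\<close>
    define x where "x t = a + t *s b + (t^2 / 2) *s (D *v a) + (t^3 / 6) *s (D *v b)" for t
    define x' where "x' t = b + t *s (D *v a) + (t^2 / 2) *s (D *v b)" for t
    have Dx: "D *v x t = D *v a + t *s (D *v b)" for t
      by (simp add: x_def matrix_vector_right_distrib vector_scalar_commute rank_one_nilpotent_square[OF nil])
    have s: "affine_symmetry D (c / 2) (mat_part g) x x'"
      unfolding affine_symmetry_def Dx
    proof (intro conjI allI)
      show "mat_part g *v (D *v v) = D *v (mat_part g *v v) + (2 * (c / 2)) *s (D *v v)" for v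
        using c[of v] by simp
      show "((\<lambda>t. x t $ k) has_field_derivative x' t $ k) (at t)" for t k
        by (auto simp: x_def x'_def intro!: derivative_eq_intros)
      show "((\<lambda>t. x' t $ k) has_field_derivative (D *v a + t *s (D *v b)) $ k) (at t)" for t k
        by (auto simp: x'_def intro!: derivative_eq_intros)
    qed
    have "mk_params (mat_part g) (x 0) (x' 0) (g $ Inr (Inr ())) \<in> params_of ` V"
      unfolding params_of_affine_field[OF s, symmetric] by (rule imageI[OF I[OF s]])
    moreover have "mk_params (mat_part g) (x 0) (x' 0) (g $ Inr (Inr ())) = g"
      by (auto simp: mk_params_def x_def x'_def a_def b_def mat_part_def
          Finite_Cartesian_Product.vec_eq_iff split: sum.split)
    ultimately show "g \<in> params_of ` V" by simp
  qed
qed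

theorem corollary3:
  fixes D :: "complex^'n^'n"
  assumes "CARD('n::finite) \<ge> 2"
    and "D \<notin> scalar_matrices"
  shows "vf_finite_dimensional (max_lie_algebra (linear_system D)) \<and>
    vf.dim (max_lie_algebra (linear_system D)) \<le> CARD('n)^2 + 4 \<and>
    (vf.dim (max_lie_algebra (linear_system D)) = CARD('n)^2 + 4 \<longleftrightarrow>
      similar_mat (to_mat D) (extremal_jordan_matrix CARD('n)))"
proof -
  let ?V = "max_lie_algebra (linear_system D)"
  note V = dim_max_lie_algebra[OF assms(2)]
  have le: "vf.dim ?V \<le> vec.dim (sym_params D)"
    unfolding V(2) by (rule vec.dim_subset[OF V(3)])
  have "D \<noteq> 0"
  proof
    assume "D = 0"
    then have "D \<in> scalar_matrices" by (intro scalar_matrixI[of _ 0]) simp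
    with assms(2) show False ..
  qed
  then have sim: "rank_one_nilpotent D \<longleftrightarrow> similar_mat (to_mat D) (extremal_jordan_matrix CARD('n))"
    using rank_one_nilpotent_if_similar[OF assms(1)] similar_if_rank_one_nilpotent[OF assms(1)] by blast
  have "vf.dim ?V = CARD('n)^2 + 4 \<longleftrightarrow> rank_one_nilpotent D"
  proof
    assume "vf.dim ?V = CARD('n)^2 + 4"
    with le dim_sym_params_le(1)[OF assms(2)] have "vec.dim (sym_params D) = CARD('n)^2 + 4" by simp
    then show "rank_one_nilpotent D" by (rule dim_sym_params_le(2)[OF assms(2)])
  next
    assume nil: "rank_one_nilpotent D"
    show "vf.dim ?V = CARD('n)^2 + 4"
      unfolding V(2) V(4)[OF nil] by (rule dim_sym_params_rank_one_nilpotent[OF assms(2) nil])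
  qed
  then show ?thesis
    unfolding sim using V(1) order_trans[OF le dim_sym_params_le(1)[OF assms(2)]] by (intro conjI)
qed

end
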